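(* Let $p\ge 1$ be an integer, let $a_1,\ldots,a_{p+1},b_1,\ldots,b_p$ be complex numbers with no $a_j$ equal to a nonpositive integer, and put $s_p=b_1+\cdots+b_p-a_1-a_2-\cdots-a_{p+1}$. Suppose $\Re(a_j)>0$ for $j=3,\ldots,p+1$. If $\Re(s_p)>0$, then the series $$g_0(0)=\frac{\Gamma(a_1)\Gamma(a_2)\Gamma(s_p)}{\Gamma(a_1+s_p)\Gamma(a_2+s_p)}\sum_{k=0}^\infty\frac{(s_p)_k}{(a_1+s_p)_k(a_2+s_p)_k}A_k^{(p)}$$ converges and $$\sum_{l=0}^{m-1}\frac{\Gamma(a_1+l)\Gamma(a_2+l)\cdots\Gamma(a_{p+1}+l)}{\Gamma(b_1+l)\cdots\Gamma(b_p+l)\Gamma(1+l)}=g_0(0)+O(m^{-s_p})$$ as $m\to\infty$ through the positive integers.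
   Context: $(x)_n=x(x+1)\cdots(x+n-1)=\Gamma(x+n)/\Gamma(x)$ is the Pochhammer symbol, $(x)_0=1$. The coefficients $A_k^{(p)}=A_k^{(p)}(a_3,\ldots,a_{p+1};b_1,\ldots,b_p)$, $k=0,1,2,\ldots$, are defined recursively in $p$: $A_0^{(1)}=1$ and $A_k^{(1)}=0$ for $k>0$; for $p\ge2$, $$A_k^{(p)}(a_3,\ldots,a_{p+1};b_1,\ldots,b_p)=\sum_{j=0}^{k}\frac{\bigl(\sum_{i=2}^{p}b_i-\sum_{i=3}^{p+1}a_i+j\bigr)_{k-j}\,(b_1-a_3)_{k-j}}{(k-j)!}\,A_j^{(p-1)}(a_4,\ldots,a_{p+1};b_2,\ldots,b_p).$$ For example $A_k^{(2)}=(b_2-a_3)_k(b_1-a_3)_k/k!$ and $A_k^{(3)}=\sum_{j=0}^k\frac{(b_3+b_2-a_4-a_3+j)_{k-j}(b_1-a_3)_{k-j}(b_3-a_4)_j(b_2-a_4)_j}{(k-j)!\,j!}$. The parameters are fixed and $m\to\infty$; for complex $s$, $O(m^{-s})$ means bounded in absolute value by a constant times $m^{-\Re(s)}$. $1/\Gamma$ is regarded as an entire function (zero at nonpositive integers), and $\frac{1}{\Gamma(x)(x)_k}$ is read as $1/\Gamma(x+k)$. *)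

theory Defs
  imports "HOL-Analysis.Analysis" "HOL-Library.Landau_Symbols"
begin

text \<open>
  The parameters are functions on the naturals; only the values \<open>a 1, \<dots>, a (p + 1)\<close> and
  \<open>b 1, \<dots>, b p\<close> are relevant.  \<open>coeffA p a b k\<close> is the coefficient
  \<open>A\<^sub>k\<close> of level \<open>p\<close> with parameters \<open>(a 3, \<dots>, a (p + 1); b 1, \<dots>, b p)\<close>.
  Shifting both parameter functions by one turns these parameters, at level \<open>p - 1\<close>, into
  \<open>(a 4, \<dots>, a (p + 1); b 2, \<dots>, b p)\<close>.  Level \<open>0\<close> is a dummy value.
\<close>

fun coeffA :: "nat \<Rightarrow> (nat \<Rightarrow> complex) \<Rightarrow> (nat \<Rightarrow> complex) \<Rightarrow> nat \<Rightarrow> complex" where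
  "coeffA 0 a b k = 0"
| "coeffA (Suc 0) a b k = (if k = 0 then 1 else 0)"
| "coeffA (Suc (Suc q)) a b k =
    (let p = Suc (Suc q) in
     \<Sum>j=0..k. pochhammer ((\<Sum>i=2..p. b i) - (\<Sum>i=3..p+1. a i) + of_nat j) (k - j)
                * pochhammer (b 1 - a 3) (k - j) / fact (k - j)
                * coeffA (p - 1) (\<lambda>i. a (i + 1)) (\<lambda>i. b (i + 1)) j)"

lemma coeffA_2:
  "coeffA 2 a b k = pochhammer (b 2 - a 3) k * pochhammer (b 1 - a 3) k / fact k"
  by (simp add: numeral_2_eq_2 numeral_3_eq_3, subst sum.remove[of _ 0]) (auto intro!: sum.neutral)

lemma coeffA_3:
  "coeffA 3 a b k =
    (\<Sum>j=0..k. pochhammer (b 3 + b 2 - a 4 - a 3 + of_nat j) (k - j) * pochhammer (b 1 - a 3) (k - j)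
                * pochhammer (b 3 - a 4) j * pochhammer (b 2 - a 4) j
                / (fact (k - j) * fact j))"
proof -
  have 1: "coeffA 3 a b k =
    (\<Sum>j=0..k. pochhammer ((\<Sum>i=2..3. b i) - (\<Sum>i=3..4. a i) + of_nat j) (k - j)
                * pochhammer (b 1 - a 3) (k - j) / fact (k - j)
                * coeffA 2 (\<lambda>i. a (i + 1)) (\<lambda>i. b (i + 1)) j)"
    by (simp add: eval_nat_numeral)
  have 2: "(\<Sum>i=2..3. b i) = b 2 + b 3" "(\<Sum>i=3..4. a i) = a 3 + a 4"
    by (simp_all add: eval_nat_numeral)
  show ?thesis
    unfolding 1 2 coeffA_2 by (rule sum.cong)
      (simp_all add: algebra_simps eval_nat_numeral)
qed

definition excess :: "nat \<Rightarrow> (nat \<Rightarrow> complex) \<Rightarrow> (nat \<Rightarrow> complex) \<Rightarrow> complex" where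
  "excess p a b = (\<Sum>i=1..p. b i) - (\<Sum>i=1..p+1. a i)"

text \<open>
  The reciprocal Gamma factors \<open>1 / (Gamma (x) * pochhammer x k)\<close>, for \<open>x\<close> equal to
  \<open>a 1 + excess p a b\<close> and \<open>a 2 + excess p a b\<close>, are written as \<open>rGamma (x + k)\<close>, which
  is also meaningful when \<open>x\<close> is a nonpositive integer; they are therefore part of the terms of
  the series rather than of its prefactor.
\<close>

definition g0_term :: "nat \<Rightarrow> (nat \<Rightarrow> complex) \<Rightarrow> (nat \<Rightarrow> complex) \<Rightarrow> nat \<Rightarrow> complex" where
  "g0_term p a b k =
    pochhammer (excess p a b) k
      * rGamma (a 1 + excess p a b + of_nat k) * rGamma (a 2 + excess p a b + of_nat k)
      * coeffA p a b k"

definition g0_at_0 :: "nat \<Rightarrow> (nat \<Rightarrow> complex) \<Rightarrow> (nat \<Rightarrow> complex) \<Rightarrow> complex" where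
  "g0_at_0 p a b = Gamma (a 1) * Gamma (a 2) * Gamma (excess p a b) * (\<Sum>k. g0_term p a b k)"

definition hyp_partial_sum ::
    "nat \<Rightarrow> (nat \<Rightarrow> complex) \<Rightarrow> (nat \<Rightarrow> complex) \<Rightarrow> nat \<Rightarrow> complex" where
  "hyp_partial_sum p a b m =
    (\<Sum>l<m. (\<Prod>j=1..p+1. Gamma (a j + of_nat l)) * (\<Prod>j=1..p. rGamma (b j + of_nat l))
             * rGamma (1 + of_nat l))"

end

theory Submission
  imports Defs "HOL-Real_Asymp.Real_Asymp"
begin

text \<open>
  Put \<open>S = s\<^sub>p + a\<^sub>1 + a\<^sub>2\<close>, which is the sum of the \<open>b\<^sub>j\<close> minus the sum of \<open>a\<^sub>3, \<dots>, a\<^sub>p\<^sub>+\<^sub>1\<close>.  The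
  coefficients \<open>A\<^sub>k\<close> are those of an inverse factorial series:
  \<open>\<Gamma>(a\<^sub>3+l) \<dots> \<Gamma>(a\<^sub>p\<^sub>+\<^sub>1+l) / (\<Gamma>(b\<^sub>1+l) \<dots> \<Gamma>(b\<^sub>p+l)) = \<Sum>\<^sub>k A\<^sub>k / \<Gamma>(S+l+k)\<close>
  (lemma \<open>coeffA_sums\<close>, with the shift by \<open>l\<close> absorbed into the parameters).  Their recursion arises
  when the expansion at level \<open>p-1\<close>, whose terms are \<open>A\<^sub>j / \<Gamma>(S'+l+j)\<close>, is multiplied by
  \<open>\<Gamma>(a\<^sub>3+l) / \<Gamma>(b\<^sub>1+l)\<close>: Gauss's theorem \<open>gauss_sum\<close> expands
  \<open>\<Gamma>(a\<^sub>3+l) / (\<Gamma>(b\<^sub>1+l) \<Gamma>(S'+l+j))\<close> into a series over \<open>n\<close>, and terms with the same \<open>k = j + n\<close>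
  are collected.  Multiplying the expansion by \<open>\<Gamma>(a\<^sub>1+l) \<Gamma>(a\<^sub>2+l) / l!\<close> and summing over \<open>l\<close>, once more
  by Gauss's theorem, turns it into the series for \<open>g\<^sub>0(0)\<close> (lemma \<open>sum_gauss_terms_swap\<close>).  So the
  hypergeometric series has the sum \<open>g\<^sub>0(0)\<close>, and since its terms are of order \<open>l\<^bsup>-s-1\<^esup>\<close>, its tails are of
  order \<open>m\<^bsup>-s\<^esup>\<close>.

  The difficulty is to collect the terms with the same \<open>j + n\<close>.  The double series need not converge absolutely
  unless \<open>Re b\<^sub>1 > Re a\<^sub>3\<close>, and nothing is assumed about the \<open>b\<^sub>j\<close>.  In lemma \<open>level_step_sums\<close> the expansion
  is therefore obtained for \<open>b\<^sub>1 + N\<close> with large \<open>N\<close> first and then carried from \<open>b\<^sub>1 + 1\<close> down to \<open>b\<^sub>1\<close>.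
  The coefficients for \<open>b\<^sub>1\<close> are twisted differences of those for \<open>b\<^sub>1 + 1\<close>, so the two series are
  related by summation by parts, and it only has to be known that the boundary term tends to zero.

  This requires an upper bound for \<open>A\<^sub>k\<close> of the right order, \<open>A\<^sub>k / k! = O(k\<^bsup>Re S - \<alpha> - 2\<^esup>)\<close> for every \<open>\<alpha>\<close>
  below all of \<open>Re a\<^sub>3, \<dots>, Re a\<^sub>p\<^sub>+\<^sub>1\<close> (lemma \<open>symbol_growth_coeffA\<close>).  The triangle inequality gives it
  only for \<open>Re b\<^sub>1 > Re a\<^sub>3\<close>; in general the recursion involves cancellation.  The cancellation is
  controlled by proving the bound together with the corresponding bounds for all iterated differences,
  each difference gaining a factor \<open>1/k\<close>.  For sequences of this kind an identity of Euler type
  (lemma \<open>level_step_raise\<close>) expresses the sum for \<open>b\<^sub>1\<close> through sums of the same shape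
  for \<open>b\<^sub>1 + 1\<close>, divided by \<open>k\<close>, until the triangle inequality suffices.
\<close>

section \<open>Sequences of polynomial growth\<close>

definition poly_growth :: "real \<Rightarrow> (nat \<Rightarrow> 'a::real_normed_field) \<Rightarrow> bool" where
  "poly_growth \<sigma> x \<longleftrightarrow> (\<lambda>k. norm (x k)) \<in> O(\<lambda>k. real k powr \<sigma>)"

lemma poly_growth_mono:
  assumes "poly_growth \<sigma> x" "\<sigma> \<le> \<tau>"
  shows "poly_growth \<tau> x"
proof -
  have "(\<lambda>k. real k powr \<sigma>) \<in> O(\<lambda>k. real k powr \<tau>)"
    by (intro bigoI[of _ 1] eventually_mono[OF eventually_ge_at_top[of 1]])
       (auto intro!: powr_mono assms(2))
  with assms(1) show ?thesis
    unfolding poly_growth_def by (rule landau_o.big_trans)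
qed

lemma poly_growth_add:
  "poly_growth \<sigma> x \<Longrightarrow> poly_growth \<sigma> y \<Longrightarrow> poly_growth \<sigma> (\<lambda>k. x k + y k)"
proof -
  assume xy: "poly_growth \<sigma> x" "poly_growth \<sigma> y"
  have "(\<lambda>k. norm (x k + y k)) \<in> O(\<lambda>k. norm (x k) + norm (y k))"
    by (rule bigoI[of _ 1]) (auto intro!: always_eventually norm_triangle_ineq)
  also have "(\<lambda>k. norm (x k) + norm (y k)) \<in> O(\<lambda>k. real k powr \<sigma>)"
    using xy unfolding poly_growth_def by (rule sum_in_bigo)
  finally show ?thesis unfolding poly_growth_def .
qed

lemma poly_growth_mult:
  "poly_growth \<sigma> x \<Longrightarrow> poly_growth \<tau> y \<Longrightarrow> poly_growth (\<sigma> + \<tau>) (\<lambda>k. x k * y k)"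
  unfolding poly_growth_def norm_mult powr_add by (rule landau_o.big.mult)

lemma poly_growth_cmult: "poly_growth \<sigma> x \<Longrightarrow> poly_growth \<sigma> (\<lambda>k. c * x k)"
  by (cases "c = 0") (simp_all add: poly_growth_def norm_mult)

lemma poly_growth_shift:
  "poly_growth \<sigma> (\<lambda>k. x (Suc k)) \<longleftrightarrow> poly_growth \<sigma> x"
proof
  assume "poly_growth \<sigma> x"
  hence "(\<lambda>k. norm (x (Suc k))) \<in> O(\<lambda>k. real (Suc k) powr \<sigma>)"
    unfolding poly_growth_def by (rule landau_o.big.compose) (rule filterlim_Suc)
  also have "(\<lambda>k. real (Suc k) powr \<sigma>) \<in> O(\<lambda>k. real k powr \<sigma>)" by real_asymp
  finally show "poly_growth \<sigma> (\<lambda>k. x (Suc k))" unfolding poly_growth_def .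
next
  assume "poly_growth \<sigma> (\<lambda>k. x (Suc k))"
  hence "(\<lambda>k. norm (x (Suc k))) \<in> O(\<lambda>k. real k powr \<sigma>)" unfolding poly_growth_def .
  also have "(\<lambda>k. real k powr \<sigma>) \<in> O(\<lambda>k. real (Suc k) powr \<sigma>)" by real_asymp
  finally obtain c where "eventually (\<lambda>k. norm (norm (x (Suc k))) \<le> c * norm (real (Suc k) powr \<sigma>)) at_top"
    by (auto elim!: landau_o.bigE)
  hence "eventually (\<lambda>k. norm (norm (x k)) \<le> c * norm (real k powr \<sigma>)) at_top"
    by (rule eventually_sequentially_Suc[THEN iffD1])
  thus "poly_growth \<sigma> x" unfolding poly_growth_def by (rule bigoI)
qed

lemma poly_growth_eventually_zero:
  assumes "\<And>k. k > N \<Longrightarrow> x k = 0"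
  shows "poly_growth \<sigma> x"
  unfolding poly_growth_def
  by (rule bigoI[of _ 0], rule eventually_mono[OF eventually_gt_at_top[of N]]) (simp add: assms)

lemma poly_growth_norm [simp]: "poly_growth \<sigma> (\<lambda>k. norm (x k)) \<longleftrightarrow> poly_growth \<sigma> x"
  by (simp add: poly_growth_def)

lemma poly_growth_dominated:
  assumes "poly_growth \<sigma> y" "\<And>k. norm (x k) \<le> norm (y k)"
  shows "poly_growth \<sigma> x"
proof -
  have "(\<lambda>k. norm (x k)) \<in> O(\<lambda>k. norm (y k))"
    by (rule bigoI[of _ 1]) (simp add: assms(2))
  also have "(\<lambda>k. norm (y k)) \<in> O(\<lambda>k. real k powr \<sigma>)"
    using assms(1) by (simp add: poly_growth_def)
  finally show ?thesis by (simp add: poly_growth_def)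
qed

lemma poly_growth_summable_norm:
  assumes "poly_growth \<sigma> x" "\<sigma> < -1"
  shows "summable (\<lambda>k. norm (x k))"
proof (rule summable_comparison_test_bigo)
  show "summable (\<lambda>k. norm (real k powr \<sigma>))"
    using assms(2) by (simp add: summable_real_powr_iff)
  show "(\<lambda>k. norm (x k)) \<in> O(\<lambda>k. real k powr \<sigma>)" using assms(1) by (simp add: poly_growth_def)
qed

lemma poly_growth_tendsto_0:
  assumes "poly_growth \<sigma> x" "\<sigma> < 0"
  shows "x \<longlonglongrightarrow> 0"
proof -
  have "(\<lambda>k. real k powr \<sigma>) \<in> o(\<lambda>_. 1)" using assms(2) by real_asymp
  with assms(1) have "(\<lambda>k. norm (x k)) \<in> o(\<lambda>_. 1)"
    unfolding poly_growth_def by (rule landau_o.big_small_trans)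
  hence "(\<lambda>k. norm (x k)) \<longlonglongrightarrow> 0" by (auto dest: smalloD_tendsto)
  thus ?thesis by (rule tendsto_norm_zero_cancel)
qed

lemma poly_growth_0_if_convergent:
  assumes "x \<longlonglongrightarrow> L"
  shows "poly_growth 0 x"
proof -
  have "Bseq x" using convergentI[OF assms] by (rule convergent_imp_Bseq)
  then obtain K where "\<And>n. norm (x n) \<le> K" by (auto simp: Bseq_def)
  thus ?thesis unfolding poly_growth_def
    by (intro bigoI[of _ K] eventually_mono[OF eventually_ge_at_top[of 1]]) auto
qed

lemma poly_growth_linear: "poly_growth 1 (\<lambda>k. u + of_nat k :: complex)"
proof -
  have "poly_growth 1 (\<lambda>k. of_nat k :: complex)"
    by (auto simp: poly_growth_def intro!: bigoI[of _ 1])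
  moreover have "poly_growth 1 (\<lambda>k. u)"
    by (rule poly_growth_mono[OF poly_growth_0_if_convergent[OF tendsto_const]]) simp
  ultimately show ?thesis by (intro poly_growth_add)
qed

lemma poly_growth_inverse_Suc: "poly_growth (-1) (\<lambda>k. inverse (of_nat (Suc k)) :: 'a::real_normed_field)"
  unfolding poly_growth_def norm_inverse norm_of_nat by simp real_asymp

lemma poly_growth_exp_ln: "poly_growth (Re z) (\<lambda>k. exp (z * of_real (ln (real k))))"
  unfolding poly_growth_def
  by (rule bigoI[of _ 1], rule eventually_mono[OF eventually_gt_at_top[of 0]])
     (simp add: powr_def)

lemma poly_growth_prod:
  fixes x :: "nat \<Rightarrow> nat \<Rightarrow> complex"
  assumes "\<And>j. j \<in> {1..p} \<Longrightarrow> poly_growth (\<sigma> j) (x j)"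
  shows "poly_growth (\<Sum>j=1..p. \<sigma> j) (\<lambda>k. \<Prod>j=1..p. x j k)"
  using assms
proof (induction p)
  case 0
  show ?case by (simp add: poly_growth_0_if_convergent[OF tendsto_const])
next
  case (Suc p)
  have "poly_growth ((\<Sum>j=1..p. \<sigma> j) + \<sigma> (Suc p)) (\<lambda>k. (\<Prod>j=1..p. x j k) * x (Suc p) k)"
    using Suc.prems by (intro poly_growth_mult Suc.IH) auto
  thus ?case by simp
qed

section \<open>Growth of all differences\<close>

definition fdiff :: "(nat \<Rightarrow> complex) \<Rightarrow> nat \<Rightarrow> complex" where
  "fdiff x k = x (Suc k) - x k"

primrec diff_growth :: "nat \<Rightarrow> real \<Rightarrow> (nat \<Rightarrow> complex) \<Rightarrow> bool" where
  "diff_growth 0 \<sigma> x \<longleftrightarrow> poly_growth \<sigma> x"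
| "diff_growth (Suc n) \<sigma> x \<longleftrightarrow> poly_growth \<sigma> x \<and> diff_growth n (\<sigma> - 1) (fdiff x)"

lemma diff_growth_imp_poly_growth: "diff_growth n \<sigma> x \<Longrightarrow> poly_growth \<sigma> x"
  by (cases n) auto

lemma diff_growth_SucD: "diff_growth (Suc n) \<sigma> x \<Longrightarrow> diff_growth n \<sigma> x"
  by (induction n arbitrary: \<sigma> x) auto

lemma diff_growth_mono: "diff_growth n \<sigma> x \<Longrightarrow> \<sigma> \<le> \<tau> \<Longrightarrow> diff_growth n \<tau> x"
  by (induction n arbitrary: \<sigma> \<tau> x) (auto intro: poly_growth_mono)

lemma diff_growth_add:
  "diff_growth n \<sigma> x \<Longrightarrow> diff_growth n \<sigma> y \<Longrightarrow> diff_growth n \<sigma> (\<lambda>k. x k + y k)"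
proof (induction n arbitrary: \<sigma> x y)
  case (Suc n)
  have "fdiff (\<lambda>k. x k + y k) = (\<lambda>k. fdiff x k + fdiff y k)" by (auto simp: fdiff_def)
  with Suc show ?case by (auto intro: poly_growth_add)
qed (auto intro: poly_growth_add)

lemma diff_growth_cmult: "diff_growth n \<sigma> x \<Longrightarrow> diff_growth n \<sigma> (\<lambda>k. c * x k)"
proof (induction n arbitrary: \<sigma> x)
  case (Suc n)
  have "fdiff (\<lambda>k. c * x k) = (\<lambda>k. c * fdiff x k)" by (auto simp: fdiff_def algebra_simps)
  with Suc show ?case by (auto intro: poly_growth_cmult)
qed (auto intro: poly_growth_cmult)

lemma diff_growth_shift:
  "diff_growth n \<sigma> (\<lambda>k. x (Suc k)) \<longleftrightarrow> diff_growth n \<sigma> x"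
proof (induction n arbitrary: \<sigma> x)
  case (Suc n)
  have "fdiff (\<lambda>k. x (Suc k)) = (\<lambda>k. fdiff x (Suc k))" by (auto simp: fdiff_def)
  with Suc show ?case by (auto simp: poly_growth_shift)
qed (auto simp: poly_growth_shift)

text \<open>
  The reason is the Leibniz rule for differences, in which one of the factors is shifted by one index.
\<close>

lemma diff_growth_mult:
  "diff_growth n \<sigma> x \<Longrightarrow> diff_growth n \<tau> y \<Longrightarrow> diff_growth n (\<sigma> + \<tau>) (\<lambda>k. x k * y k)"
proof (induction n arbitrary: \<sigma> \<tau> x y)
  case (Suc n)
  have eq: "fdiff (\<lambda>k. x k * y k) = (\<lambda>k. fdiff x k * y k + x (Suc k) * fdiff y k)"
    by (auto simp: fdiff_def algebra_simps)
  have 1: "diff_growth n ((\<sigma> - 1) + \<tau>) (\<lambda>k. fdiff x k * y k)"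
    using Suc.prems by (intro Suc.IH) (auto dest: diff_growth_SucD simp del: diff_growth.simps(2) simp: diff_growth.simps(2)[of n \<sigma> x])
  have 2: "diff_growth n (\<sigma> + (\<tau> - 1)) (\<lambda>k. x (Suc k) * fdiff y k)"
    using Suc.prems diff_growth_SucD[OF Suc.prems(1)] by (intro Suc.IH) (simp_all add: diff_growth_shift)
  have "diff_growth n (\<sigma> + \<tau> - 1) (fdiff (\<lambda>k. x k * y k))"
    unfolding eq using 1 2 by (intro diff_growth_add) (simp_all add: algebra_simps)
  with Suc.prems show ?case by (auto intro: poly_growth_mult)
qed (auto intro: poly_growth_mult)

lemma diff_growth_eventually_zero:
  "(\<And>k. k > N \<Longrightarrow> x k = 0) \<Longrightarrow> diff_growth n \<sigma> x"
  by (induction n arbitrary: \<sigma> x) (auto intro: poly_growth_eventually_zero simp: fdiff_def)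

text \<open>
  This is the discrete analogue of the symbol classes of analysis. The finite orders \<open>diff_growth n\<close>
  serve only for inductions over \<open>n\<close>.
\<close>

definition symbol_growth :: "real \<Rightarrow> (nat \<Rightarrow> complex) \<Rightarrow> bool" where
  "symbol_growth \<sigma> x \<longleftrightarrow> (\<forall>n. diff_growth n \<sigma> x)"

lemma symbol_growthD: "symbol_growth \<sigma> x \<Longrightarrow> poly_growth \<sigma> x"
  unfolding symbol_growth_def using diff_growth_imp_poly_growth by blast

lemma symbol_growth_mono: "symbol_growth \<sigma> x \<Longrightarrow> \<sigma> \<le> \<tau> \<Longrightarrow> symbol_growth \<tau> x"
  unfolding symbol_growth_def by (blast intro: diff_growth_mono)

lemma symbol_growth_add:
  "symbol_growth \<sigma> x \<Longrightarrow> symbol_growth \<sigma> y \<Longrightarrow> symbol_growth \<sigma> (\<lambda>k. x k + y k)"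
  unfolding symbol_growth_def by (blast intro: diff_growth_add)

lemma symbol_growth_cmult: "symbol_growth \<sigma> x \<Longrightarrow> symbol_growth \<sigma> (\<lambda>k. c * x k)"
  unfolding symbol_growth_def by (blast intro: diff_growth_cmult)

lemma symbol_growth_mult:
  "symbol_growth \<sigma> x \<Longrightarrow> symbol_growth \<tau> y \<Longrightarrow> symbol_growth (\<sigma> + \<tau>) (\<lambda>k. x k * y k)"
  unfolding symbol_growth_def by (blast intro: diff_growth_mult)

lemma symbol_growth_shift: "symbol_growth \<sigma> (\<lambda>k. x (Suc k)) \<longleftrightarrow> symbol_growth \<sigma> x"
  unfolding symbol_growth_def by (simp add: diff_growth_shift)

lemma symbol_growth_fdiff: "symbol_growth \<sigma> x \<Longrightarrow> symbol_growth (\<sigma> - 1) (fdiff x)"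
  unfolding symbol_growth_def by (metis diff_growth.simps(2))

section \<open>Binomial coefficients and reciprocal Gamma values\<close>

lemma not_nonpos_Int_if_Re_pos: "Re z > 0 \<Longrightarrow> z \<notin> \<int>\<^sub>\<le>\<^sub>0"
  by (auto elim!: nonpos_Ints_cases)

lemma add_nat_not_nonpos_Int:
  fixes z :: complex
  obtains N where "z + of_nat N \<notin> \<int>\<^sub>\<le>\<^sub>0"
proof -
  obtain N where "- Re z < real N" using reals_Archimedean2 by blast
  hence "Re (z + of_nat N) > 0" by simp
  hence "z + of_nat N \<notin> \<int>\<^sub>\<le>\<^sub>0" by (force elim!: nonpos_Ints_cases)
  thus ?thesis by (rule that)
qed

text \<open>
  These are the coefficients of the power series of \<open>(1 - z)\<^bsup>-u\<^esup>\<close>.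
\<close>

definition rising :: "'a::field_char_0 \<Rightarrow> nat \<Rightarrow> 'a" where
  "rising u k = pochhammer u k / fact k"

lemma rising_0 [simp]: "rising u 0 = 1"
  by (simp add: rising_def)

lemma rising_1 [simp]: "rising 1 k = 1"
  by (simp add: rising_def flip: pochhammer_fact)

lemma rising_Suc: "of_nat (Suc k) * rising u (Suc k) = (u + of_nat k) * rising u k"
  by (simp add: rising_def pochhammer_Suc field_simps del: of_nat_Suc)

lemma rising_Suc': "of_nat (Suc k) * rising u (Suc k) = u * rising (u + 1) k"
  by (simp add: rising_def pochhammer_rec field_simps del: of_nat_Suc)

text \<open>
  Multiplication of the generating function by \<open>1 - z\<close> lowers the exponent by one.
\<close>

lemma rising_diff: "rising u (Suc k) - rising u k = rising (u - 1) (Suc k)"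
proof -
  have "of_nat (Suc k) * (rising u (Suc k) - rising u k) = of_nat (Suc k) * rising (u - 1) (Suc k)"
    using rising_Suc[of k u] rising_Suc'[of k "u - 1"] by (simp add: algebra_simps)
  thus ?thesis by (simp del: of_nat_Suc)
qed

lemma sum_rising_mult: "(\<Sum>j\<le>k. rising u j * rising v (k - j)) = rising (u + v) k"
proof -
  have "(\<Sum>j\<le>k. rising u j * rising v (k - j)) =
        (\<Sum>j\<le>k. of_nat (k choose j) * pochhammer u j * pochhammer v (k - j)) / fact k"
    unfolding sum_divide_distrib
    by (intro sum.cong refl) (auto simp: rising_def binomial_fact)
  thus ?thesis by (simp add: rising_def pochhammer_binomial_sum)
qed

lemma of_real_rising: "of_real (rising s k) = (rising (of_real s) k :: complex)"
  by (simp add: rising_def pochhammer_of_real)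

lemma rising_nonneg: "s > 0 \<Longrightarrow> rising (s::real) k \<ge> 0"
  by (simp add: rising_def pochhammer_nonneg)

lemma poly_growth_rising: "poly_growth (Re u - 1) (rising u)"
proof -
  have "poly_growth (0 + (Re u + (-1)))
    (\<lambda>k. rGamma_series u k * (exp (u * of_real (ln (real k))) * inverse (of_nat (Suc k))))"
  proof (intro poly_growth_mult poly_growth_exp_ln poly_growth_inverse_Suc)
    show "poly_growth 0 (rGamma_series u)"
      by (rule poly_growth_0_if_convergent[OF rGamma_series_LIMSEQ])
  qed
  also have "(\<lambda>k. rGamma_series u k * (exp (u * of_real (ln (real k))) * inverse (of_nat (Suc k)))) =
             (\<lambda>k. rising u (Suc k))"
    by (auto simp: rGamma_series_def rising_def fun_eq_iff divide_simps simp del: of_nat_Suc)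
  finally show ?thesis by (simp add: poly_growth_shift)
qed

lemma diff_growth_rising: "diff_growth n (Re u - 1) (rising u)"
proof (induction n arbitrary: u)
  case (Suc n)
  have "fdiff (rising u) = (\<lambda>k. rising (u - 1) (Suc k))" by (auto simp: fdiff_def rising_diff)
  with Suc[of "u - 1"] show ?case by (simp add: poly_growth_rising diff_growth_shift)
qed (simp add: poly_growth_rising)

text \<open>
  Away from the poles of \<open>\<Gamma>\<close> this is Euler's limit formula for \<open>\<Gamma>(v)\<close>. A nonpositive integer
  \<open>v\<close> is reached from \<open>v + N\<close> by the functional equation, which costs a factor of order \<open>k\<close> per
  step and changes the claimed exponent by the same amount.
\<close>

lemma poly_growth_fact_rGamma: "poly_growth (1 - Re v) (\<lambda>k. fact k * rGamma (v + of_nat k))"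
proof -
  have nonpole: "poly_growth (1 - Re v) (\<lambda>k. fact k * rGamma (v + of_nat k))"
    if "v \<notin> \<int>\<^sub>\<le>\<^sub>0" for v :: complex
  proof -
    have "poly_growth (0 + (Re (-v) + 1))
      (\<lambda>k. Gamma_series v k * (exp ((-v) * of_real (ln (real k))) * (1 + of_nat k)))"
      by (intro poly_growth_mult poly_growth_exp_ln poly_growth_linear
            poly_growth_0_if_convergent[OF Gamma_series_LIMSEQ])
    hence "poly_growth (1 - Re v) (\<lambda>k. rGamma v *
      (Gamma_series v k * (exp ((-v) * of_real (ln (real k))) * (1 + of_nat k))))"
      by (intro poly_growth_cmult) simp
    also have "(\<lambda>k. rGamma v *
      (Gamma_series v k * (exp ((-v) * of_real (ln (real k))) * (1 + of_nat k)))) =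
      (\<lambda>k. fact (Suc k) * rGamma (v + of_nat (Suc k)))"
    proof
      fix k
      have "pochhammer v (Suc k) \<noteq> 0"
        using that by (auto simp: pochhammer_eq_0_iff)
      thus "rGamma v *
      (Gamma_series v k * (exp ((-v) * of_real (ln (real k))) * (1 + of_nat k))) =
      fact (Suc k) * rGamma (v + of_nat (Suc k))"
        by (subst pochhammer_rGamma[of v "Suc k"]) (simp add: Gamma_series_def exp_minus field_simps)
    qed
    finally show ?thesis
      by (rule poly_growth_shift[where x = "\<lambda>k. fact k * rGamma (v + of_nat k)", THEN iffD1])
  qed
  have "poly_growth (1 - Re v) (\<lambda>k. fact k * rGamma (v + of_nat k))"
    if "v + of_nat N \<notin> \<int>\<^sub>\<le>\<^sub>0" for v :: complex and N
    using that
  proof (induction N arbitrary: v)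
    case (Suc N)
    have "poly_growth (1 - Re (v + 1)) (\<lambda>k. fact k * rGamma ((v + 1) + of_nat k))"
      using Suc.prems by (intro Suc.IH) (simp add: add_ac)
    hence "poly_growth (1 + (1 - Re (v + 1))) (\<lambda>k. (v + of_nat k) * (fact k * rGamma ((v + 1) + of_nat k)))"
      by (intro poly_growth_mult poly_growth_linear)
    moreover have "(v + of_nat k) * (fact k * rGamma ((v + 1) + of_nat k)) = fact k * rGamma (v + of_nat k)" for k
      using rGamma_plus1[of "v + of_nat k"] by (simp add: add_ac mult_ac)
    ultimately show ?case by simp
  qed (use nonpole in simp)
  moreover obtain N where "v + of_nat N \<notin> \<int>\<^sub>\<le>\<^sub>0" by (rule add_nat_not_nonpos_Int)
  ultimately show ?thesis by blast
qed

lemma diff_growth_fact_rGamma: "diff_growth n (1 - Re v) (\<lambda>k. fact k * rGamma (v + of_nat k))"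
proof (induction n arbitrary: v)
  case (Suc n)
  have "fdiff (\<lambda>k. fact k * rGamma (v + of_nat k)) =
        (\<lambda>k. (1 - v) * (fact k * rGamma ((v + 1) + of_nat k)))"
  proof
    fix k
    show "fdiff (\<lambda>k. fact k * rGamma (v + of_nat k)) k = (1 - v) * (fact k * rGamma ((v + 1) + of_nat k))"
      using rGamma_plus1[of "v + of_nat k", symmetric]
      by (simp add: fdiff_def algebra_simps)
  qed
  with Suc[of "v + 1"] show ?case by (auto simp: poly_growth_fact_rGamma intro!: diff_growth_cmult)
qed (simp add: poly_growth_fact_rGamma)

lemma poly_growth_fact_div_pochhammer:
  assumes "v \<notin> \<int>\<^sub>\<le>\<^sub>0"
  shows "poly_growth (1 - Re v) (\<lambda>k. fact k / pochhammer v k)"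
proof -
  have "fact k / pochhammer v k = Gamma v * (fact k * rGamma (v + of_nat k))" for k
    using assms pochhammer_rGamma[of v k] Gamma_eq_zero_iff[of v] rGamma_inverse_Gamma[of v]
    by (cases "pochhammer v k = 0") (auto simp: field_simps pochhammer_eq_0_iff)
  thus ?thesis using poly_growth_cmult[OF poly_growth_fact_rGamma[of v]] by simp
qed

text \<open>
  The sequence \<open>rising s\<close> is positive and has the exact order \<open>k\<^bsup>s - 1\<^esup>\<close>, so it can replace powers of
  \<open>k\<close> as a majorant. Convolutions of such majorants are then evaluated exactly by \<open>sum_rising_mult\<close>.
\<close>

lemma poly_growth_le_rising:
  fixes x :: "nat \<Rightarrow> complex"
  assumes "poly_growth (s - 1) x" "s > 0"
  obtains C where "C \<ge> 0" "\<And>k. norm (x k) \<le> C * rising s k"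
proof -
  have pos: "pochhammer s k > 0" for k by (rule pochhammer_pos[OF assms(2)])
  have "complex_of_real s \<notin> \<int>\<^sub>\<le>\<^sub>0" using assms(2) by (auto elim!: nonpos_Ints_cases simp: complex_eq_iff)
  hence "poly_growth ((s - 1) + (1 - s)) (\<lambda>k. x k * (fact k / pochhammer (of_real s) k))"
    using poly_growth_fact_div_pochhammer[of "of_real s"] by (intro poly_growth_mult assms(1)) auto
  hence "(\<lambda>k. norm (x k * (fact k / pochhammer (of_real s) k))) \<in> O(\<lambda>k. real k powr 0)"
    by (simp add: poly_growth_def)
  then obtain c where "c > 0" and
    "eventually (\<lambda>k. norm (norm (x k * (fact k / pochhammer (of_real s) k))) \<le> c * norm (real k powr 0)) at_top"
    by (rule landau_o.bigE)
  from this(2) have "eventually (\<lambda>k. norm (x k * (fact k / pochhammer (of_real s) k)) \<le> c) at_top"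
    using eventually_gt_at_top[of 0] by eventually_elim simp
  hence "Bseq (\<lambda>k. x k * (fact k / pochhammer (of_real s) k))"
    by (rule BfunI)
  then obtain C where C: "C > 0" "\<And>k. norm (x k * (fact k / pochhammer (of_real s) k)) \<le> C"
    by (auto simp: Bseq_def)
  show ?thesis
  proof (rule that[of C])
    fix k
    have "norm (x k * (fact k / pochhammer (of_real s) k)) = norm (x k) * (fact k / pochhammer s k)"
      using pos[of k] by (simp add: norm_mult norm_divide pochhammer_of_real)
    with C(2)[of k] have "norm (x k) * (fact k / pochhammer s k) \<le> C" by simp
    thus "norm (x k) \<le> C * rising s k"
      using pos[of k] by (simp add: rising_def field_simps)
  qed (use C in simp)
qed

lemma poly_growth_Gamma_ratio:
  assumes "u \<notin> \<int>\<^sub>\<le>\<^sub>0"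
  shows "poly_growth (Re u - Re v) (\<lambda>k. Gamma (u + of_nat k) * rGamma (v + of_nat k))"
proof -
  have "poly_growth ((Re u - 1) + (1 - Re v)) (\<lambda>k. Gamma u * (rising u k * (fact k * rGamma (v + of_nat k))))"
    by (intro poly_growth_cmult poly_growth_mult poly_growth_rising poly_growth_fact_rGamma)
  moreover have "Gamma u * (rising u k * (fact k * rGamma (v + of_nat k))) =
     Gamma (u + of_nat k) * rGamma (v + of_nat k)" for k
    using assms by (simp add: rising_def pochhammer_Gamma Gamma_eq_zero_iff)
  ultimately show ?thesis by simp
qed

lemma symbol_growth_const: "symbol_growth 0 (\<lambda>k. u)"
proof -
  have "rising 1 = (\<lambda>k. 1 :: complex)" by auto
  hence "symbol_growth 0 (\<lambda>k. 1)"
    using diff_growth_rising[of _ 1] by (simp add: symbol_growth_def)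
  from symbol_growth_cmult[OF this, of u] show ?thesis by simp
qed

lemma symbol_growth_of_nat: "symbol_growth 1 of_nat"
proof -
  have eq: "rising 2 k = (of_nat (Suc k) :: complex)" for k
    using rising_Suc'[of k "1 :: complex"] by simp
  have "symbol_growth 1 (rising 2)"
    using diff_growth_rising[of _ 2] by (simp add: symbol_growth_def)
  hence "symbol_growth 1 (\<lambda>k. rising 2 k + (-1))"
    by (intro symbol_growth_add symbol_growth_mono[OF symbol_growth_const]) auto
  thus ?thesis by (simp add: eq)
qed

lemma symbol_growth_inverse_Suc: "symbol_growth (-1) (\<lambda>k. inverse (of_nat (Suc k)))"
proof -
  have "fact k * rGamma (2 + of_nat k) = inverse (of_nat (Suc k) :: complex)" for k
  proof -
    have "Gamma (2 + of_nat k :: complex) = fact (Suc k)"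
      using Gamma_fact[of "Suc k", where ?'a = complex] by (simp add: add_ac)
    thus ?thesis by (simp add: rGamma_inverse_Gamma field_simps del: of_nat_Suc)
  qed
  with diff_growth_fact_rGamma[of _ 2] show ?thesis by (simp add: symbol_growth_def)
qed

section \<open>One step of the recursion for the coefficients\<close>

text \<open>
  One step of the recursion for the coefficients \<open>A\<^sub>k\<close>: here \<open>\<mu>\<close> stands for \<open>b\<^sub>1 - a\<^sub>3\<close>,
  and \<open>c\<close> does not involve \<open>b\<^sub>1\<close>, so that changes of \<open>b\<^sub>1\<close> are changes of \<open>\<mu>\<close> alone. If \<open>c\<close> is
  not a nonpositive integer, dividing by \<open>pochhammer c k\<close> turns the step into multiplication of the generating
  function by \<open>(1 - z)\<^bsup>-\<mu>\<^esup>\<close>; the formula below also covers the other values of \<open>c\<close>.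
\<close>

definition level_step :: "complex \<Rightarrow> complex \<Rightarrow> (nat \<Rightarrow> complex) \<Rightarrow> nat \<Rightarrow> complex" where
  "level_step c \<mu> A k = (\<Sum>j\<le>k. pochhammer (c + of_nat j) (k - j) * rising \<mu> (k - j) * A j)"

text \<open>
  Lowering \<open>\<mu>\<close> by one is a difference operation, twisted by the Pochhammer factors.
\<close>

lemma level_step_diff:
  "level_step c \<mu> A (Suc k) - (c + of_nat k) * level_step c \<mu> A k = level_step c (\<mu> - 1) A (Suc k)"
proof -
  have "(\<Sum>j\<le>k. pochhammer (c + of_nat j) (Suc k - j) * rising \<mu> (Suc k - j) * A j)
        - (c + of_nat k) * (\<Sum>j\<le>k. pochhammer (c + of_nat j) (k - j) * rising \<mu> (k - j) * A j)
      = (\<Sum>j\<le>k. pochhammer (c + of_nat j) (Suc k - j) * rising (\<mu> - 1) (Suc k - j) * A j)"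
    unfolding sum_distrib_left sum_subtractf[symmetric]
  proof (rule sum.cong)
    fix j assume "j \<in> {..k}"
    then obtain n where "k = j + n" by (auto simp: le_iff_add)
    thus "pochhammer (c + of_nat j) (Suc k - j) * rising \<mu> (Suc k - j) * A j -
         (c + of_nat k) * (pochhammer (c + of_nat j) (k - j) * rising \<mu> (k - j) * A j) =
         pochhammer (c + of_nat j) (Suc k - j) * rising (\<mu> - 1) (Suc k - j) * A j"
      by (simp add: pochhammer_Suc flip: rising_diff) (simp add: algebra_simps)
  qed simp
  thus ?thesis by (simp add: level_step_def algebra_simps)
qed

definition euler_input :: "complex \<Rightarrow> (nat \<Rightarrow> complex) \<Rightarrow> nat \<Rightarrow> complex" where
  "euler_input c A j =
    (case j of 0 \<Rightarrow> 0 | Suc i \<Rightarrow> of_nat (Suc i) * A (Suc i) - of_nat i * (c + of_nat i) * A i)"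

text \<open>
  For the generating functions of the sequences divided by \<open>pochhammer c k\<close>, this is what \<open>z d/dz\<close> does to \<open>(1 - z)\<^bsup>-\<mu>\<^esup> X(z)\<close>: the derivative falls either on
  the power, which raises \<open>\<mu>\<close>, or on \<open>X\<close>, where \<open>X'\<close> is written as \<open>(1 - z)\<^bsup>-1\<^esup> (1 - z) X'\<close>, so that \<open>\<mu>\<close> is raised
  again and \<open>X\<close> is replaced by \<open>(1 - z) z X'\<close>. The coefficients of the latter are \<open>euler_input\<close>.
\<close>

lemma level_step_raise:
  "of_nat (Suc k) * level_step c \<mu> A (Suc k) =
     \<mu> * (c + of_nat k) * level_step c (\<mu> + 1) A k + level_step c (\<mu> + 1) (euler_input c A) (Suc k)"
proof -
  define P where "P = (\<lambda>j. pochhammer (c + of_nat j) (k - j) * (c + of_nat k) * A j)"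
  have poch: "pochhammer (c + of_nat j) (Suc k - j) = pochhammer (c + of_nat j) (k - j) * (c + of_nat k)"
    if "j \<le> k" for j
    using that by (simp add: Suc_diff_le pochhammer_Suc add_ac of_nat_diff)
  have poch': "(c + of_nat j) * pochhammer (c + of_nat (Suc j)) (k - j) =
        pochhammer (c + of_nat j) (k - j) * (c + of_nat k)" if "j \<le> k" for j
    using poch[OF that] that by (simp add: Suc_diff_le pochhammer_rec add_ac)
  have "level_step c (\<mu> + 1) (euler_input c A) (Suc k) =
    (\<Sum>j\<le>Suc k. pochhammer (c + of_nat j) (Suc k - j) * rising (\<mu> + 1) (Suc k - j) * (of_nat j * A j)) -
    (\<Sum>j\<le>k. pochhammer (c + of_nat (Suc j)) (k - j) * rising (\<mu> + 1) (k - j) * (of_nat j * (c + of_nat j) * A j))"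
    unfolding level_step_def sum.atMost_Suc_shift euler_input_def
    by (simp add: sum_subtractf algebra_simps flip: sum.distrib)
  also have "(\<Sum>j\<le>k. pochhammer (c + of_nat (Suc j)) (k - j) * rising (\<mu> + 1) (k - j) * (of_nat j * (c + of_nat j) * A j)) =
    (\<Sum>j\<le>k. P j * rising (\<mu> + 1) (k - j) * of_nat j)"
  proof (intro sum.cong refl)
    fix j assume "j \<in> {..k}"
    have "pochhammer (c + of_nat (Suc j)) (k - j) * rising (\<mu> + 1) (k - j) * (of_nat j * (c + of_nat j) * A j) =
      ((c + of_nat j) * pochhammer (c + of_nat (Suc j)) (k - j)) * (rising (\<mu> + 1) (k - j) * (of_nat j * A j))"
      by (simp only: mult_ac)
    also have "\<dots> = P j * rising (\<mu> + 1) (k - j) * of_nat j"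
      using \<open>j \<in> {..k}\<close> by (subst poch') (simp_all only: P_def mult_ac atMost_iff)
    finally show "pochhammer (c + of_nat (Suc j)) (k - j) * rising (\<mu> + 1) (k - j) * (of_nat j * (c + of_nat j) * A j) =
      P j * rising (\<mu> + 1) (k - j) * of_nat j" .
  qed
  also have "(\<Sum>j\<le>Suc k. pochhammer (c + of_nat j) (Suc k - j) * rising (\<mu> + 1) (Suc k - j) * (of_nat j * A j)) =
    (\<Sum>j\<le>k. P j * rising (\<mu> + 1) (Suc k - j) * of_nat j) + of_nat (Suc k) * A (Suc k)"
    by (simp add: poch P_def mult_ac)
  finally have E: "level_step c (\<mu> + 1) (euler_input c A) (Suc k) =
    (\<Sum>j\<le>k. P j * rising (\<mu> + 1) (Suc k - j) * of_nat j) + of_nat (Suc k) * A (Suc k) -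
    (\<Sum>j\<le>k. P j * rising (\<mu> + 1) (k - j) * of_nat j)" .
  have L: "(c + of_nat k) * level_step c (\<mu> + 1) A k = (\<Sum>j\<le>k. P j * rising (\<mu> + 1) (k - j))"
    by (simp add: level_step_def P_def sum_distrib_left mult_ac)
  have "\<mu> * (c + of_nat k) * level_step c (\<mu> + 1) A k + level_step c (\<mu> + 1) (euler_input c A) (Suc k) =
    (\<Sum>j\<le>k. P j * (\<mu> * rising (\<mu> + 1) (k - j) +
      of_nat j * (rising (\<mu> + 1) (Suc k - j) - rising (\<mu> + 1) (k - j)))) + of_nat (Suc k) * A (Suc k)"
    unfolding mult.assoc[of \<mu>] L E
    by (simp add: sum_distrib_left sum.distrib sum_subtractf algebra_simps)
  also have "\<dots> = (\<Sum>j\<le>k. P j * (of_nat (Suc k) * rising \<mu> (Suc k - j))) + of_nat (Suc k) * A (Suc k)"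
  proof (intro arg_cong2[of _ _ _ _ "(+)"] sum.cong refl arg_cong2[of _ _ _ _ "(*)"])
    fix j assume "j \<in> {..k}"
    then obtain n where n: "k = j + n" by (auto simp: le_iff_add)
    show "\<mu> * rising (\<mu> + 1) (k - j) + of_nat j * (rising (\<mu> + 1) (Suc k - j) - rising (\<mu> + 1) (k - j)) =
      of_nat (Suc k) * rising \<mu> (Suc k - j)"
      using rising_diff[of "\<mu> + 1" n] rising_Suc'[of n \<mu>] by (simp add: n algebra_simps)
  qed
  also have "\<dots> = of_nat (Suc k) * level_step c \<mu> A (Suc k)"
    by (simp add: level_step_def poch P_def sum_distrib_left distrib_left mult_ac del: of_nat_Suc)
  finally show ?thesis by simp
qed

text \<open>
  For positive \<open>Re \<mu>\<close> no cancellation has to be used. If \<open>c\<close> is not a nonpositive integer, division by \<open>pochhammer c k\<close>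
  reduces the sum to a convolution, which is bounded by the Vandermonde convolution of two sequences
  \<open>rising\<close>; the lower bound on \<open>\<tau>\<close> makes the first parameter positive. If it is one, splitting off the
  term \<open>j = 0\<close> leaves a sum of the same form for \<open>c + 1\<close>.
\<close>

lemma poly_growth_level_step_majorant:
  assumes "poly_growth \<tau> (\<lambda>k. A k / fact k)" "\<tau> > Re c - 2" "Re \<mu> > 0"
  shows "poly_growth (\<tau> + Re \<mu>)
    (\<lambda>k. (\<Sum>j\<le>k. norm (pochhammer (c + of_nat j) (k - j) * rising \<mu> (k - j) * A j)) / fact k)"
proof -
  define B where "B = (\<lambda>c A k. \<Sum>j\<le>k. norm (pochhammer (c + of_nat j) (k - j) * rising \<mu> (k - j) * A j))"
  have nonpole: "poly_growth (\<tau> + Re \<mu>) (\<lambda>k. B c A k / fact k)"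
    if growth: "poly_growth \<tau> (\<lambda>k. A k / fact k)" and \<tau>: "\<tau> > Re c - 2" and c: "c \<notin> \<int>\<^sub>\<le>\<^sub>0" for c A \<tau>
  proof -
    \<comment> \<open>The order of \<open>A k / pochhammer c k\<close> is \<open>s - 1\<close>.\<close>
    define s where "s = \<tau> + 2 - Re c"
    have s: "s > 0" using \<tau> by (simp add: s_def)
    have "poly_growth (\<tau> + (1 - Re c)) (\<lambda>k. A k / fact k * (fact k / pochhammer c k))"
      by (intro poly_growth_mult growth poly_growth_fact_div_pochhammer c)
    hence gr: "poly_growth (s - 1) (\<lambda>k. A k / pochhammer c k)" by (simp add: s_def algebra_simps)
    obtain C1 where C1: "C1 \<ge> 0" "\<And>k. norm (A k / pochhammer c k) \<le> C1 * rising s k"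
      by (rule poly_growth_le_rising[OF gr s]) (rule that)
    obtain C2 where C2: "C2 \<ge> 0" "\<And>k. norm (rising \<mu> k) \<le> C2 * rising (Re \<mu>) k"
      by (rule poly_growth_le_rising[OF poly_growth_rising assms(3)]) (rule that)
    have "B c A k / fact k \<le> norm (rising c k) * (C1 * C2 * rising (s + Re \<mu>) k)" for k
    proof -
      have "B c A k / fact k = (\<Sum>j\<le>k. norm (rising c k) * (norm (A j / pochhammer c j) * norm (rising \<mu> (k - j))))"
        unfolding B_def sum_divide_distrib
      proof (intro sum.cong refl)
        fix j assume "j \<in> {..k}"
        hence "pochhammer c k = pochhammer c j * pochhammer (c + of_nat j) (k - j)"
          by (intro pochhammer_product) auto
        moreover have "pochhammer c j \<noteq> 0" using c by (auto simp: pochhammer_eq_0_iff)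
        ultimately show "norm (pochhammer (c + of_nat j) (k - j) * rising \<mu> (k - j) * A j) / fact k =
           norm (rising c k) * (norm (A j / pochhammer c j) * norm (rising \<mu> (k - j)))"
          by (simp add: rising_def norm_mult norm_divide mult_ac)
      qed
      also have "\<dots> \<le> (\<Sum>j\<le>k. norm (rising c k) * ((C1 * rising s j) * (C2 * rising (Re \<mu>) (k - j))))"
        using C1 C2 s by (intro sum_mono mult_left_mono mult_mono) (auto simp: rising_nonneg)
      also have "\<dots> = norm (rising c k) * (C1 * C2 * rising (s + Re \<mu>) k)"
        by (simp add: sum_distrib_left mult_ac flip: sum_rising_mult)
      finally show ?thesis .
    qed
    moreover have "B c A k \<ge> 0" for k by (simp add: B_def sum_nonneg)
    moreover have "rising (s + Re \<mu>) k \<ge> 0" for k using s assms(3) by (intro rising_nonneg) auto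
    ultimately have le: "norm (B c A k / fact k) \<le> norm (rising c k * (of_real (C1 * C2) * rising (of_real (s + Re \<mu>)) k))" for k
      using C1(1) C2(1) by (simp add: norm_mult flip: of_real_rising of_real_add)
    have "poly_growth ((Re c - 1) + (Re (of_real (s + Re \<mu>)) - 1))
            (\<lambda>k. rising c k * (of_real (C1 * C2) * rising (of_real (s + Re \<mu>)) k))"
      by (intro poly_growth_mult poly_growth_cmult poly_growth_rising)
    hence "poly_growth (\<tau> + Re \<mu>) (\<lambda>k. rising c k * (of_real (C1 * C2) * rising (of_real (s + Re \<mu>)) k))"
      by (simp add: s_def algebra_simps)
    thus ?thesis using le by (rule poly_growth_dominated)
  qed
  have "poly_growth (\<tau> + Re \<mu>) (\<lambda>k. B c A k / fact k)"
    if "poly_growth \<tau> (\<lambda>k. A k / fact k)" "\<tau> > Re c - 2" "c + of_nat N \<notin> \<int>\<^sub>\<le>\<^sub>0" for c A \<tau> N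
    using that
  proof (induction N arbitrary: c A \<tau>)
    case (Suc N)
    have peel: "B c A (Suc k) / fact (Suc k) =
        norm (A 0 * rising c (Suc k) * rising \<mu> (Suc k)) + inverse (real (Suc k)) * (B (c + 1) (\<lambda>k. A (Suc k)) k / fact k)" for k
      unfolding B_def sum.atMost_Suc_shift
      by (simp add: norm_mult norm_divide rising_def field_simps del: of_nat_Suc fact_Suc)
         (simp add: add_ac fact_Suc field_simps)
    have "poly_growth (\<tau> + 1) (\<lambda>k. A (Suc k) / fact k)"
    proof -
      have "poly_growth (1 + \<tau>) (\<lambda>k. (1 + of_nat k) * (A (Suc k) / fact (Suc k)))"
        using Suc.prems(1) poly_growth_shift[of \<tau> "\<lambda>k. A k / fact k"]
        by (intro poly_growth_mult poly_growth_linear) auto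
      moreover have "(1 + of_nat k) * (A (Suc k) / fact (Suc k)) = A (Suc k) / fact k" for k
        by (simp flip: of_nat_Suc)
      ultimately show ?thesis by (simp add: add_ac)
    qed
    hence "poly_growth (\<tau> + 1 + Re \<mu>) (\<lambda>k. B (c + 1) (\<lambda>k. A (Suc k)) k / fact k)"
      using Suc.prems(2,3) by (intro Suc.IH) (auto simp: add_ac)
    hence "poly_growth (- 1 + (\<tau> + 1 + Re \<mu>)) (\<lambda>k. inverse (real (Suc k)) * (B (c + 1) (\<lambda>k. A (Suc k)) k / fact k))"
      by (intro poly_growth_mult poly_growth_inverse_Suc)
    hence 1: "poly_growth (\<tau> + Re \<mu>) (\<lambda>k. inverse (real (Suc k)) * (B (c + 1) (\<lambda>k. A (Suc k)) k / fact k))"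
      by simp
    have "poly_growth ((Re c - 1) + (Re \<mu> - 1)) (\<lambda>k. (A 0 * rising c (Suc k)) * rising \<mu> (Suc k))"
      by (intro poly_growth_mult poly_growth_cmult) (simp_all add: poly_growth_shift poly_growth_rising)
    hence "poly_growth (\<tau> + Re \<mu>) (\<lambda>k. (A 0 * rising c (Suc k)) * rising \<mu> (Suc k))"
      by (rule poly_growth_mono) (use Suc.prems(2) in simp)
    hence 2: "poly_growth (\<tau> + Re \<mu>) (\<lambda>k. norm ((A 0 * rising c (Suc k)) * rising \<mu> (Suc k)))"
      by simp
    from poly_growth_add[OF 2 1] have "poly_growth (\<tau> + Re \<mu>) (\<lambda>k. B c A (Suc k) / fact (Suc k))"
      unfolding peel .
    thus ?case by (rule poly_growth_shift[where x = "\<lambda>k. B c A k / fact k", THEN iffD1])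
  qed (use nonpole in simp)
  moreover obtain N where "c + of_nat N \<notin> \<int>\<^sub>\<le>\<^sub>0" by (rule add_nat_not_nonpos_Int)
  ultimately show ?thesis using assms unfolding B_def by blast
qed

text \<open>
  Multiplication by \<open>j\<close> followed by a difference preserves the order of growth. The summand
  with \<open>1 - c\<close> in the proof is what the twist by \<open>c\<close> adds.
\<close>

lemma symbol_growth_euler_input:
  assumes "symbol_growth \<tau> (\<lambda>k. A k / fact k)"
  shows "symbol_growth \<tau> (\<lambda>k. euler_input c A k / fact k)"
proof -
  define a where "a = (\<lambda>k. A k / fact k)"
  have a: "symbol_growth \<tau> a" using assms by (simp add: a_def)
  have "symbol_growth (1 + \<tau> - 1) (fdiff (\<lambda>k. of_nat k * a k))"
    by (intro symbol_growth_fdiff symbol_growth_mult symbol_growth_of_nat a)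
  moreover have "symbol_growth ((1 + -1) + \<tau>) (\<lambda>k. (of_nat k * inverse (of_nat (Suc k))) * a k)"
    by (intro symbol_growth_mult symbol_growth_of_nat symbol_growth_inverse_Suc a)
  ultimately have "symbol_growth \<tau> (\<lambda>k. fdiff (\<lambda>k. of_nat k * a k) k +
      (1 - c) * ((of_nat k * inverse (of_nat (Suc k))) * a k))"
    by (intro symbol_growth_add symbol_growth_cmult) simp_all
  also have "(\<lambda>k. fdiff (\<lambda>k. of_nat k * a k) k +
      (1 - c) * ((of_nat k * inverse (of_nat (Suc k))) * a k)) =
      (\<lambda>k. euler_input c A (Suc k) / fact (Suc k))"
  proof
    fix k
    have A: "A j = a j * fact j" for j by (simp add: a_def)
    have "1 + of_nat k \<noteq> (0 :: complex)" by (metis of_nat_Suc of_nat_neq_0)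
    thus "fdiff (\<lambda>k. of_nat k * a k) k + (1 - c) * ((of_nat k * inverse (of_nat (Suc k))) * a k) =
          euler_input c A (Suc k) / fact (Suc k)"
      by (simp add: euler_input_def fdiff_def A divide_simps) (simp add: algebra_simps)
  qed
  finally show ?thesis
    by (rule symbol_growth_shift[where x = "\<lambda>k. euler_input c A k / fact k", THEN iffD1])
qed

text \<open>
  Raising \<open>\<mu>\<close> to a positive real part takes finitely many applications of \<open>level_step_raise\<close>. Each raises
  the exponent of the bound by one and divides by the index, so the order \<open>\<tau> + Re \<mu>\<close> results in every case.
\<close>

lemma poly_growth_level_step:
  assumes "symbol_growth \<tau> (\<lambda>k. A k / fact k)" "\<tau> > Re c - 2"
  shows "poly_growth (\<tau> + Re \<mu>) (\<lambda>k. level_step c \<mu> A k / fact k)"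
proof -
  have "poly_growth (\<tau> + Re \<mu>) (\<lambda>k. level_step c \<mu> A k / fact k)"
    if "symbol_growth \<tau> (\<lambda>k. A k / fact k)" "Re \<mu> + real N > 0" for \<mu> N A
    using that
  proof (induction N arbitrary: \<mu> A)
    case 0
    have "poly_growth (\<tau> + Re \<mu>) (\<lambda>k. (\<Sum>j\<le>k. norm (pochhammer (c + of_nat j) (k - j) * rising \<mu> (k - j) * A j)) / fact k)"
      using 0 assms(2) by (intro poly_growth_level_step_majorant symbol_growthD) auto
    thus ?case
      by (rule poly_growth_dominated)
         (auto simp: norm_divide level_step_def sum_nonneg intro!: divide_right_mono norm_sum)
  next
    case (Suc N)
    define L where "L = (\<lambda>k. level_step c (\<mu> + 1) A k / fact k)"
    define L' where "L' = (\<lambda>k. level_step c (\<mu> + 1) (euler_input c A) k / fact k)"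
    have pos: "Re (\<mu> + 1) + real N > 0" using Suc.prems(2) by simp
    have L: "poly_growth (\<tau> + Re (\<mu> + 1)) L" and L': "poly_growth (\<tau> + Re (\<mu> + 1)) L'"
      unfolding L_def L'_def using Suc.prems(1) pos
      by (blast intro: Suc.IH symbol_growth_euler_input)+
    have "poly_growth (-1 + (1 + (\<tau> + Re (\<mu> + 1)))) (\<lambda>k. inverse (of_nat (Suc k)) * ((c + of_nat k) * L k))"
      by (intro poly_growth_mult poly_growth_inverse_Suc poly_growth_linear L)
    hence "poly_growth (\<tau> + Re (\<mu> + 1))
       (\<lambda>k. \<mu> * (inverse (of_nat (Suc k)) * ((c + of_nat k) * L k)) + L' (Suc k))"
      using L' by (intro poly_growth_add poly_growth_cmult) (simp_all add: poly_growth_shift add_ac)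
    hence "poly_growth (-1 + (\<tau> + Re (\<mu> + 1)))
       (\<lambda>k. inverse (of_nat (Suc k)) * (\<mu> * (inverse (of_nat (Suc k)) * ((c + of_nat k) * L k)) + L' (Suc k)))"
      by (intro poly_growth_mult poly_growth_inverse_Suc)
    also have "(\<lambda>k. inverse (of_nat (Suc k)) * (\<mu> * (inverse (of_nat (Suc k)) * ((c + of_nat k) * L k)) + L' (Suc k))) =
       (\<lambda>k. level_step c \<mu> A (Suc k) / fact (Suc k))"
    proof
      fix k
      have "level_step c \<mu> A (Suc k) = inverse (of_nat (Suc k)) *
        (\<mu> * (c + of_nat k) * level_step c (\<mu> + 1) A k + level_step c (\<mu> + 1) (euler_input c A) (Suc k))"
        unfolding level_step_raise[symmetric] by (simp del: of_nat_Suc)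
      thus "inverse (of_nat (Suc k)) * (\<mu> * (inverse (of_nat (Suc k)) * ((c + of_nat k) * L k)) + L' (Suc k)) =
        level_step c \<mu> A (Suc k) / fact (Suc k)"
        by (simp add: L_def L'_def field_simps del: of_nat_Suc)
    qed
    finally have "poly_growth (\<tau> + Re \<mu>) (\<lambda>k. level_step c \<mu> A (Suc k) / fact (Suc k))"
      by simp
    thus ?case by (rule poly_growth_shift[where x = "\<lambda>k. level_step c \<mu> A k / fact k", THEN iffD1])
  qed
  moreover obtain N where "- Re \<mu> < real N" using reals_Archimedean2 by blast
  hence "Re \<mu> + real N > 0" by simp
  ultimately show ?thesis using assms(1) by blast
qed

text \<open>
  Up to a summand that carries an additional factor \<open>1/k\<close>, a difference of the output is the output for
  \<open>\<mu> - 1\<close>. So the bounds for all \<open>\<mu>\<close> contain those for all differences.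
\<close>

lemma symbol_growth_level_step:
  assumes "symbol_growth \<tau> (\<lambda>k. A k / fact k)" "\<tau> > Re c - 2"
  shows "symbol_growth (\<tau> + Re \<mu>) (\<lambda>k. level_step c \<mu> A k / fact k)"
proof -
  have "diff_growth n (\<tau> + Re \<mu>) (\<lambda>k. level_step c \<mu> A k / fact k)" for n
  proof (induction n arbitrary: \<mu>)
    case (Suc n)
    have eq: "fdiff (\<lambda>k. level_step c \<mu> A k / fact k) =
      (\<lambda>k. level_step c (\<mu> - 1) A (Suc k) / fact (Suc k) +
           (c - 1) * (inverse (of_nat (Suc k)) * (level_step c \<mu> A k / fact k)))"
    proof
      fix k
      have "1 + of_nat k \<noteq> (0 :: complex)" by (metis of_nat_Suc of_nat_neq_0)
      thus "fdiff (\<lambda>k. level_step c \<mu> A k / fact k) k =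
        level_step c (\<mu> - 1) A (Suc k) / fact (Suc k) +
           (c - 1) * (inverse (of_nat (Suc k)) * (level_step c \<mu> A k / fact k))"
        unfolding level_step_diff[symmetric]
        by (simp add: fdiff_def divide_simps) (simp add: algebra_simps)
    qed
    have "diff_growth n (-1 + (\<tau> + Re \<mu>)) (\<lambda>k. inverse (of_nat (Suc k)) * (level_step c \<mu> A k / fact k))"
      using symbol_growth_inverse_Suc by (intro diff_growth_mult Suc.IH) (simp add: symbol_growth_def)
    moreover have "diff_growth n (\<tau> + Re (\<mu> - 1)) (\<lambda>k. level_step c (\<mu> - 1) A (Suc k) / fact (Suc k))"
      using Suc.IH[of "\<mu> - 1"] by (rule diff_growth_shift[where x = "\<lambda>k. level_step c (\<mu> - 1) A k / fact k", THEN iffD2])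
    ultimately have "diff_growth n (\<tau> + Re \<mu> - 1) (fdiff (\<lambda>k. level_step c \<mu> A k / fact k))"
      unfolding eq by (intro diff_growth_add diff_growth_cmult) (simp_all add: algebra_simps)
    with poly_growth_level_step[OF assms] show ?case by simp
  qed (use poly_growth_level_step[OF assms] in simp)
  thus ?thesis by (simp add: symbol_growth_def)
qed

section \<open>Interchange of summations\<close>

lemma suminf_swap:
  fixes f :: "nat \<Rightarrow> nat \<Rightarrow> complex"
  assumes row: "\<And>k. summable (\<lambda>l. norm (f k l))"
    and total: "summable (\<lambda>k. \<Sum>l. norm (f k l))"
  shows "(\<lambda>l. \<Sum>k. f k l) sums (\<Sum>k. \<Sum>l. f k l)" and "summable (\<lambda>k. norm (f k l))"
proof -
  define F where "F = (\<lambda>(k, l). f k l)"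
  have hs: "((\<lambda>l. norm (f k l)) has_sum (\<Sum>l. norm (f k l))) UNIV" for k
    using row[of k] by (intro sums_nonneg_imp_has_sum) (auto simp: summable_sums)
  have Fabs: "(\<lambda>z. norm (F z)) summable_on (UNIV \<times> UNIV)"
    unfolding Infinite_Sum.abs_summable_on_Sigma_iff
  proof (intro conjI ballI)
    fix k show "(\<lambda>l. norm (F (k, l))) summable_on UNIV"
      using hs[of k] by (auto simp: F_def summable_on_def)
    have "(\<lambda>k. \<Sum>l. norm (f k l)) summable_on UNIV"
      using total by (subst summable_on_UNIV_nonneg_real_iff) (auto intro!: suminf_nonneg row)
    thus "(\<lambda>k. norm (\<Sum>\<^sub>\<infinity>l. norm (F (k, l)))) summable_on UNIV"
      by (simp add: F_def infsumI[OF hs] suminf_nonneg row)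
  qed
  hence F': "(\<lambda>z. norm ((\<lambda>(k, l). f l k) z)) summable_on (UNIV \<times> UNIV)"
    using summable_on_reindex_bij_betw[of prod.swap "UNIV \<times> UNIV" "UNIV \<times> UNIV" "\<lambda>z. norm (F z)"]
    by (simp add: F_def case_prod_unfold bij_betw_def product_swap)
  have F: "(\<lambda>(k, l). f k l) summable_on (UNIV \<times> UNIV)"
    using Fabs unfolding F_def by (rule abs_summable_summable)
  note Fa = F'[unfolded Infinite_Sum.abs_summable_on_Sigma_iff, simplified]
  show col: "summable (\<lambda>k. norm (f k l))" for l
    using Fa summable_on_UNIV_nonneg_real_iff[of "\<lambda>k. norm (f k l)"] by simp
  have hc: "((\<lambda>k. f k l) has_sum (\<Sum>k. f k l)) UNIV" for l
    using col[of l] by (intro norm_summable_imp_has_sum) (auto simp: summable_norm_cancel summable_sums)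
  have hr: "((\<lambda>l. f k l) has_sum (\<Sum>l. f k l)) UNIV" for k
    using row[of k] by (intro norm_summable_imp_has_sum) (auto simp: summable_norm_cancel summable_sums)
  have sr: "(\<lambda>k. \<Sum>l. f k l) summable_on UNIV"
    using summable_on_Sigma_banach[OF F] by (simp add: infsumI[OF hr])
  have sc: "(\<lambda>l. \<Sum>k. f k l) summable_on UNIV"
    using summable_on_Sigma_banach[OF abs_summable_summable[OF F']] by (simp add: infsumI[OF hc])
  have *: "(\<Sum>\<^sub>\<infinity>k. \<Sum>l. f k l) = (\<Sum>\<^sub>\<infinity>l. \<Sum>k. f k l)"
    using infsum_swap_banach[OF F] by (simp add: infsumI[OF hr] infsumI[OF hc])
  have "(\<lambda>l. \<Sum>k. f k l) sums (\<Sum>\<^sub>\<infinity>l. \<Sum>k. f k l)"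
    by (rule has_sum_imp_sums[OF has_sum_infsum[OF sc]])
  moreover have "(\<lambda>k. \<Sum>l. f k l) sums (\<Sum>\<^sub>\<infinity>k. \<Sum>l. f k l)"
    by (rule has_sum_imp_sums[OF has_sum_infsum[OF sr]])
  ultimately show "(\<lambda>l. \<Sum>k. f k l) sums (\<Sum>k. \<Sum>l. f k l)"
    using * by (simp add: sums_iff)
qed

lemma suminf_triangle:
  fixes f :: "nat \<Rightarrow> nat \<Rightarrow> complex"
  assumes "summable (\<lambda>k. \<Sum>j\<le>k. norm (f j (k - j)))"
  shows "(\<lambda>k. \<Sum>j\<le>k. f j (k - j)) sums (\<Sum>j. \<Sum>n. f j n)"
proof -
  \<comment> \<open>Padding the triangle with zeros makes it a rectangle, rows indexed by \<open>k = j + n\<close>.\<close>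
  define g where "g = (\<lambda>k j. if j \<le> k then f j (k - j) else 0)"
  have gs: "(\<lambda>j. h (g k j)) sums (\<Sum>j\<le>k. h (f j (k - j)))"
    if "h 0 = 0" for k and h :: "complex \<Rightarrow> 'b::real_normed_vector"
  proof -
    have "(\<lambda>j. h (g k j)) sums (\<Sum>j\<le>k. h (g k j))"
      by (rule sums_finite) (auto simp: g_def that)
    thus ?thesis by (simp add: g_def)
  qed
  have col: "(\<lambda>k. h (g k j)) sums s \<longleftrightarrow> (\<lambda>n. h (f j n)) sums s"
    if "h 0 = 0" for j s and h :: "complex \<Rightarrow> 'b::real_normed_vector"
    using sums_iff_shift[of "\<lambda>k. h (g k j)" j s] that by (simp add: g_def)
  have 1: "summable (\<lambda>j. norm (g k j))" for k
    using gs[of norm] by (auto simp: summable_def)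
  have 2: "summable (\<lambda>k. \<Sum>j. norm (g k j))"
    using gs[of norm] assms by (simp add: sums_iff)
  note sw = suminf_swap[of g, OF 1 2]
  have s: "summable (\<lambda>n. norm (f j n))" for j
    using sw(2)[of j] col[of norm j] by (auto simp: summable_def)
  have eq: "(\<Sum>k. g k j) = (\<Sum>n. f j n)" for j
    using col[of "\<lambda>x. x" j "\<Sum>n. f j n"] summable_norm_cancel[OF s[of j]]
    by (simp add: sums_iff)
  have eq': "(\<Sum>j. g k j) = (\<Sum>j\<le>k. f j (k - j))" for k
    using gs[of "\<lambda>x. x" k] by (simp add: sums_iff)
  have "summable (\<lambda>k. \<Sum>j\<le>k. f j (k - j))"
    by (rule summable_comparison_test[OF _ assms]) (auto intro!: exI[of _ 0] norm_sum)
  moreover have "(\<Sum>j. \<Sum>n. f j n) = (\<Sum>k. \<Sum>j\<le>k. f j (k - j))"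
    using sw(1) unfolding eq eq' by (simp add: sums_iff)
  ultimately show "(\<lambda>k. \<Sum>j\<le>k. f j (k - j)) sums (\<Sum>j. \<Sum>n. f j n)"
    by (simp add: sums_iff)
qed

section \<open>Gauss's summation theorem\<close>

text \<open>
  The terms of \<open>\<^sub>2F\<^sub>1(A, B; C; 1) / \<Gamma>(C)\<close>; with this normalisation nonpositive integers \<open>C\<close> are
  allowed.
\<close>

definition gauss_term :: "complex \<Rightarrow> complex \<Rightarrow> complex \<Rightarrow> nat \<Rightarrow> complex" where
  "gauss_term A B C n = pochhammer A n * rising B n * rGamma (C + of_nat n)"

lemma poly_growth_gauss_term: "poly_growth (Re (A + B - C) - 1) (gauss_term A B C)"
proof -
  have "poly_growth ((Re A - 1) + ((Re B - 1) + (1 - Re C)))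
    (\<lambda>n. rising A n * (rising B n * (fact n * rGamma (C + of_nat n))))"
    by (intro poly_growth_mult poly_growth_rising poly_growth_fact_rGamma)
  moreover have "rising A n * (rising B n * (fact n * rGamma (C + of_nat n))) = gauss_term A B C n" for n
    by (simp add: gauss_term_def rising_def)
  ultimately show ?thesis by (simp add: algebra_simps)
qed

lemma summable_norm_gauss_term:
  "Re (C - A - B) > 0 \<Longrightarrow> summable (\<lambda>n. norm (gauss_term A B C n))"
  by (rule poly_growth_summable_norm[OF poly_growth_gauss_term]) simp

text \<open>
  The difference of the two sides is a telescoping series.
\<close>

lemma gauss_term_contiguous:
  assumes "Re (C - A - B) > 0"
  shows "(C - A - B) * (\<Sum>n. gauss_term A B C n) = (C - A) * (C - B) * (\<Sum>n. gauss_term A B (C + 1) n)"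
proof -
  \<comment> \<open>The sequence of which the terms are differences; it is of order \<open>n\<^bsup>Re (A + B - C)\<^esup>\<close> and so tends to zero.\<close>
  define u where "u = (\<lambda>n. - (of_nat n * gauss_term A B C n))"
  have tele: "u (Suc n) - u n = (C - A - B) * gauss_term A B C n - (C - A) * (C - B) * gauss_term A B (C + 1) n" for n
  proof -
    define t where "t = pochhammer A n * rising B n * rGamma (C + of_nat n + 1)"
    have 1: "gauss_term A B C n = (C + of_nat n) * t"
      using rGamma_plus1[of "C + of_nat n"] by (simp add: gauss_term_def t_def mult_ac)
    have 2: "gauss_term A B (C + 1) n = t"
      by (simp add: gauss_term_def t_def add_ac)
    have "of_nat (Suc n) * gauss_term A B C (Suc n) =
       pochhammer A (Suc n) * (of_nat (Suc n) * rising B (Suc n)) * rGamma (C + of_nat n + 1)"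
      by (simp add: gauss_term_def add_ac mult_ac)
    also have "\<dots> = (A + of_nat n) * (B + of_nat n) * t"
      unfolding rising_Suc by (simp add: pochhammer_Suc t_def mult_ac)
    finally have 3: "of_nat (Suc n) * gauss_term A B C (Suc n) = (A + of_nat n) * (B + of_nat n) * t" .
    show ?thesis unfolding u_def 3 1 2 by (simp add: algebra_simps)
  qed
  have "poly_growth (1 + (Re (A + B - C) - 1)) (\<lambda>n. (0 + of_nat n) * gauss_term A B C n)"
    by (intro poly_growth_mult poly_growth_linear poly_growth_gauss_term)
  hence "(\<lambda>n. (0 + of_nat n) * gauss_term A B C n) \<longlonglongrightarrow> 0"
    by (rule poly_growth_tendsto_0) (use assms in simp)
  hence "u \<longlonglongrightarrow> 0" unfolding u_def by (auto intro: tendsto_eq_intros)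
  hence "(\<lambda>n. u (Suc n) - u n) sums (0 - u 0)" by (rule telescope_sums)
  hence s: "(\<lambda>n. u (Suc n) - u n) sums 0" by (simp add: u_def)
  have "summable (gauss_term A B C)" "summable (gauss_term A B (C + 1))"
    using assms by (auto intro!: summable_norm_cancel[OF summable_norm_gauss_term])
  hence "(\<lambda>n. (C - A - B) * gauss_term A B C n - (C - A) * (C - B) * gauss_term A B (C + 1) n) sums
     ((C - A - B) * (\<Sum>n. gauss_term A B C n) - (C - A) * (C - B) * (\<Sum>n. gauss_term A B (C + 1) n))"
    by (intro sums_diff sums_mult summable_sums)
  with s show ?thesis unfolding tele by (auto dest: sums_unique2)
qed

lemma gauss_term_contiguous_iterate:
  assumes "Re (C - A - B) > 0"
  shows "pochhammer (C - A - B) m * (\<Sum>n. gauss_term A B C n) =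
           pochhammer (C - A) m * pochhammer (C - B) m * (\<Sum>n. gauss_term A B (C + of_nat m) n)"
proof (induction m)
  case (Suc m)
  have *: "(C - A - B + of_nat m) * (\<Sum>n. gauss_term A B (C + of_nat m) n) =
     (C - A + of_nat m) * (C - B + of_nat m) * (\<Sum>n. gauss_term A B (C + of_nat (Suc m)) n)"
    using gauss_term_contiguous[of "C + of_nat m" A B] assms by (simp add: algebra_simps)
  have "pochhammer (C - A - B) (Suc m) * (\<Sum>n. gauss_term A B C n) =
    (C - A - B + of_nat m) * (pochhammer (C - A - B) m * (\<Sum>n. gauss_term A B C n))"
    by (simp add: pochhammer_Suc mult_ac)
  also have "\<dots> = pochhammer (C - A) m * pochhammer (C - B) m *
     ((C - A - B + of_nat m) * (\<Sum>n. gauss_term A B (C + of_nat m) n))"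
    unfolding Suc.IH by (simp only: mult_ac)
  also have "\<dots> = pochhammer (C - A) (Suc m) * pochhammer (C - B) (Suc m) * (\<Sum>n. gauss_term A B (C + of_nat (Suc m)) n)"
    unfolding * by (simp only: pochhammer_Suc mult_ac)
  finally show ?case .
qed simp

lemma norm_pochhammer_mono:
  fixes z :: complex
  assumes "Re z > 0"
  shows "norm (pochhammer z n) \<le> norm (pochhammer (z + of_nat m) n)"
proof (induction n)
  case (Suc n)
  have "norm (z + of_nat n) \<le> norm (z + of_nat m + of_nat n)"
    using assms by (auto simp: cmod_def intro!: power_mono)
  with Suc show ?case unfolding pochhammer_Suc norm_mult by (intro mult_mono) auto
qed simp

text \<open>
  After multiplication by \<open>\<Gamma>(C + m)\<close>, every term with \<open>n \<ge> 1\<close> is, compared to its value for \<open>m = 0\<close>,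
  smaller by at least the factor \<open>\<bar>C\<bar> / \<bar>C + m\<bar>\<close>, which comes from the first factor of the Pochhammer symbol.
\<close>

lemma gauss_term_limit:
  assumes "Re (C - A - B) > 0" "Re C > 0"
  shows "(\<lambda>m. Gamma (C + of_nat m) * (\<Sum>n. gauss_term A B (C + of_nat m) n)) \<longlonglongrightarrow> 1"
proof -
  have nonpole: "C + of_nat m \<notin> \<int>\<^sub>\<le>\<^sub>0" for m
  proof -
    have "Re (C + of_nat m) > 0" using assms(2) by simp
    thus ?thesis by (rule not_nonpos_Int_if_Re_pos)
  qed
  have C0: "C \<noteq> 0" using assms(2) by auto
  define K where "K = norm C * (\<Sum>n. norm (Gamma C * gauss_term A B C (Suc n)))"
  have sm: "summable (\<lambda>n. norm (gauss_term A B (C + of_nat m) n))" for m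
    using assms by (intro summable_norm_gauss_term) auto
  have smK: "summable (\<lambda>n. norm (Gamma C * gauss_term A B C (Suc n)))"
    using sm[of 0] summable_Suc_iff[of "\<lambda>n. norm (gauss_term A B C n)"]
    by (auto simp: norm_mult intro!: summable_mult)
  have eq: "Gamma (C + of_nat m) * gauss_term A B (C + of_nat m) n =
     pochhammer A n * rising B n / pochhammer (C + of_nat m) n" for m n
  proof -
    have "pochhammer (C + of_nat m) n \<noteq> 0" using nonpole[of m] by (auto simp: pochhammer_eq_0_iff)
    thus ?thesis
      using pochhammer_rGamma[of "C + of_nat m" n] Gamma_eq_zero_iff[of "C + of_nat m"] nonpole[of m]
      by (simp add: gauss_term_def rGamma_inverse_Gamma field_simps)
  qed
  have ge: "norm (pochhammer (C + of_nat m) (Suc n)) \<ge> norm (C + of_nat m) / norm C * norm (pochhammer C (Suc n))" for m n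
  proof -
    have "norm (pochhammer (C + 1) n) \<le> norm (pochhammer (C + 1 + of_nat m) n)"
      using assms(2) by (intro norm_pochhammer_mono) simp
    hence "norm (C + of_nat m) * norm (pochhammer (C + 1) n) \<le> norm (C + of_nat m) * norm (pochhammer (C + of_nat m + 1) n)"
      by (intro mult_left_mono) (auto simp: add_ac)
    thus ?thesis using C0 by (simp add: pochhammer_rec norm_mult)
  qed
  have bound: "norm (Gamma (C + of_nat m) * (\<Sum>n. gauss_term A B (C + of_nat m) n) - 1) \<le> K / norm (C + of_nat m)" for m
  proof -
    define x where "x = (\<lambda>n. Gamma (C + of_nat m) * gauss_term A B (C + of_nat m) n)"
    have le: "norm (x (Suc n)) \<le> norm C / norm (C + of_nat m) * norm (Gamma C * gauss_term A B C (Suc n))" for n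
    proof -
      have "pochhammer C (Suc n) \<noteq> 0" using nonpole[of 0] by (auto simp: pochhammer_eq_0_iff)
      moreover have "C + of_nat m \<noteq> 0" using nonpole[of m] by auto
      ultimately have "norm (C + of_nat m) / norm C * norm (pochhammer C (Suc n)) > 0"
        using C0 by simp
      from divide_left_mono[OF ge _ mult_pos_pos[OF less_le_trans[OF this ge] this]]
      have "norm (x (Suc n)) \<le> norm (pochhammer A (Suc n) * rising B (Suc n)) / (norm (C + of_nat m) / norm C * norm (pochhammer C (Suc n)))"
        unfolding x_def eq norm_divide by simp
      also have "\<dots> = norm C / norm (C + of_nat m) * norm (Gamma C * gauss_term A B C (Suc n))"
        using eq[of 0 "Suc n"] by (simp add: norm_divide mult_ac)
      finally show ?thesis .
    qed
    have sx: "summable (\<lambda>n. norm (x n))"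
      unfolding x_def norm_mult by (intro summable_mult sm)
    have x0: "x 0 = 1" using nonpole[of m] by (simp add: x_def eq)
    have "(\<Sum>n. x n) = 1 + (\<Sum>n. x (Suc n))"
      using suminf_split_head[OF summable_norm_cancel[OF sx]] x0 by simp
    moreover have "(\<Sum>n. x n) = Gamma (C + of_nat m) * (\<Sum>n. gauss_term A B (C + of_nat m) n)"
      unfolding x_def by (rule suminf_mult[OF summable_norm_cancel[OF sm]])
    ultimately have "norm (Gamma (C + of_nat m) * (\<Sum>n. gauss_term A B (C + of_nat m) n) - 1) = norm (\<Sum>n. x (Suc n))"
      by (metis add_diff_cancel_left')
    also have "\<dots> \<le> (\<Sum>n. norm (x (Suc n)))"
      using sx by (intro summable_norm) (simp add: summable_Suc_iff[of "\<lambda>n. norm (x n)"])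
    also have "\<dots> \<le> (\<Sum>n. norm C / norm (C + of_nat m) * norm (Gamma C * gauss_term A B C (Suc n)))"
      using sx by (intro suminf_le le summable_mult smK) (simp add: summable_Suc_iff[of "\<lambda>n. norm (x n)"])
    also have "\<dots> = K / norm (C + of_nat m)"
      unfolding K_def by (subst suminf_mult[OF smK]) simp
    finally show ?thesis .
  qed
  have lim: "(\<lambda>m. K / norm (C + of_nat m)) \<longlonglongrightarrow> 0"
  proof (rule tendsto_divide_0[OF tendsto_const filterlim_at_top_imp_at_infinity])
    have "filterlim (\<lambda>m. C + of_nat m) at_infinity sequentially"
      by (rule tendsto_add_filterlim_at_infinity[OF tendsto_const tendsto_of_nat])
    thus "filterlim (\<lambda>m. norm (C + of_nat m)) at_top sequentially"
      by (rule filterlim_at_infinity_imp_norm_at_top)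
  qed
  have "(\<lambda>m. Gamma (C + of_nat m) * (\<Sum>n. gauss_term A B (C + of_nat m) n) - 1) \<longlonglongrightarrow> 0"
    by (rule Lim_null_comparison[OF always_eventually[OF allI[OF bound]] lim])
  thus ?thesis by (rule LIM_zero_cancel)
qed

text \<open>
  The contiguous relation moves \<open>C\<close> to \<open>C + m\<close>, and the limit \<open>m \<rightarrow> \<infinity>\<close> is evaluated by Euler's limit formula
  for the four Gamma values. That argument divides by \<open>\<Gamma>(C + m)\<close> and is carried out for \<open>Re C > 0\<close>;
  finitely many further contiguous relations give the other values of \<open>C\<close>.
\<close>

lemma gauss_sum:
  assumes "Re (C - A - B) > 0"
  shows "(\<Sum>n. gauss_term A B C n) = Gamma (C - A - B) * rGamma (C - A) * rGamma (C - B)"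
proof -
  have right: "(\<Sum>n. gauss_term A B C n) = Gamma (C - A - B) * rGamma (C - A) * rGamma (C - B)"
    if d: "Re (C - A - B) > 0" and C: "Re C > 0" for C
  proof -
    \<comment> \<open>\<open>e z m\<close> is the factor \<open>m\<^bsup>z\<^esup>\<close> in Euler's limit formula.\<close>
    define e where "e = (\<lambda>z m. exp (z * of_real (ln (real m))) :: complex)"
    have e: "e (y + z) m = e y m * e z m" for y z m by (simp add: e_def exp_add distrib_right)
    have poch: "pochhammer z (Suc m) = rGamma_series z m * (fact m * e z m)" for z m
      by (simp add: rGamma_series_def e_def)
    have Cn: "C \<notin> \<int>\<^sub>\<le>\<^sub>0" using C by (rule not_nonpos_Int_if_Re_pos)
    have "(\<lambda>m. rGamma_series (C - A) m * rGamma_series (C - B) m * (rGamma C / rGamma_series C m) *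
         (Gamma (C + of_nat (Suc m)) * (\<Sum>n. gauss_term A B (C + of_nat (Suc m)) n)))
       \<longlonglongrightarrow> rGamma (C - A) * rGamma (C - B) * (rGamma C / rGamma C) * 1"
      using Cn by (intro tendsto_intros rGamma_series_LIMSEQ LIMSEQ_Suc[OF gauss_term_limit] d C)
        (auto simp: rGamma_eq_zero_iff)
    moreover have "rGamma_series (C - A) m * rGamma_series (C - B) m * (rGamma C / rGamma_series C m) *
         (Gamma (C + of_nat (Suc m)) * (\<Sum>n. gauss_term A B (C + of_nat (Suc m)) n)) =
       rGamma_series (C - A - B) m * (\<Sum>n. gauss_term A B C n)" for m
    proof -
      define G where "G = (\<Sum>n. gauss_term A B (C + of_nat (Suc m)) n)"
      define F where "F = (\<Sum>n. gauss_term A B C n)"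
      have Cm: "C + of_nat (Suc m) \<notin> \<int>\<^sub>\<le>\<^sub>0"
      proof -
        have "Re (C + of_nat (Suc m)) > 0" using C by simp
        thus ?thesis by (rule not_nonpos_Int_if_Re_pos)
      qed
      have nz: "fact m * e z m \<noteq> 0" for z by (simp add: e_def)
      have rs: "rGamma_series C m \<noteq> 0"
        using Cn poch[of C m] by (auto simp: pochhammer_eq_0_iff)
      have "rGamma C = rGamma_series C m * (fact m * e C m) * rGamma (C + of_nat (Suc m))"
        by (simp only: flip: pochhammer_rGamma poch)
      hence r: "rGamma C / rGamma_series C m * Gamma (C + of_nat (Suc m)) = fact m * e C m"
        using rs Cm by (simp add: rGamma_inverse_Gamma[of "C + of_nat (Suc m)"] Gamma_eq_zero_iff del: of_nat_Suc)
      have "e (C - A) m * e (C - B) m = e (C - A - B) m * e C m"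
        by (simp flip: e add: algebra_simps)
      hence "(fact m * e (C - A) m) * (fact m * e (C - B) m) = (fact m * e (C - A - B) m) * (fact m * e C m)"
        by (simp add: mult_ac)
      moreover have "rGamma_series (C - A - B) m * (fact m * e (C - A - B) m) * F =
        rGamma_series (C - A) m * rGamma_series (C - B) m * ((fact m * e (C - A) m) * (fact m * e (C - B) m)) * G"
        using gauss_term_contiguous_iterate[OF d, of "Suc m"] unfolding poch F_def G_def by (simp add: mult_ac)
      ultimately have "(fact m * e (C - A - B) m) * (rGamma_series (C - A - B) m * F) =
         (fact m * e (C - A - B) m) * (rGamma_series (C - A) m * rGamma_series (C - B) m * (fact m * e C m) * G)"
        by (simp only: mult_ac)
      hence "rGamma_series (C - A - B) m * F = rGamma_series (C - A) m * rGamma_series (C - B) m * (fact m * e C m) * G"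
        by (rule mult_left_cancel[OF nz, THEN iffD1])
      thus ?thesis unfolding F_def[symmetric] G_def[symmetric] r[symmetric] by (simp only: mult_ac)
    qed
    ultimately have "(\<lambda>m. rGamma_series (C - A - B) m * (\<Sum>n. gauss_term A B C n))
       \<longlonglongrightarrow> rGamma (C - A) * rGamma (C - B) * (rGamma C / rGamma C) * 1" by simp
    moreover have "(\<lambda>m. rGamma_series (C - A - B) m * (\<Sum>n. gauss_term A B C n))
       \<longlonglongrightarrow> rGamma (C - A - B) * (\<Sum>n. gauss_term A B C n)"
      by (intro tendsto_intros)
    ultimately have "rGamma (C - A - B) * (\<Sum>n. gauss_term A B C n) = rGamma (C - A) * rGamma (C - B) * (rGamma C / rGamma C) * 1"
      by (rule LIMSEQ_unique[rotated])
    moreover have "C - A - B \<notin> \<int>\<^sub>\<le>\<^sub>0" using d by (rule not_nonpos_Int_if_Re_pos)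
    ultimately show ?thesis
      using Cn by (simp add: rGamma_inverse_Gamma Gamma_eq_zero_iff field_simps)
  qed
  obtain N where "- Re C < real N" using reals_Archimedean2 by blast
  hence N: "Re (C + of_nat N) > 0" by simp
  define d where "d = C - A - B"
  have d0: "d \<notin> \<int>\<^sub>\<le>\<^sub>0" using assms unfolding d_def by (rule not_nonpos_Int_if_Re_pos)
  have "Re (C + of_nat N - A - B) > 0" using assms by simp
  from right[OF this N] have "(\<Sum>n. gauss_term A B (C + of_nat N) n) =
    Gamma (d + of_nat N) * rGamma (C - A + of_nat N) * rGamma (C - B + of_nat N)"
    by (simp add: d_def algebra_simps)
  hence "pochhammer d N * (\<Sum>n. gauss_term A B C n) =
     Gamma (d + of_nat N) * (pochhammer (C - A) N * rGamma (C - A + of_nat N)) *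
       (pochhammer (C - B) N * rGamma (C - B + of_nat N))"
    using gauss_term_contiguous_iterate[OF assms, of N] by (simp add: d_def mult_ac)
  also have "\<dots> = Gamma (d + of_nat N) * rGamma (C - A) * rGamma (C - B)"
    by (simp flip: pochhammer_rGamma)
  also have "Gamma (d + of_nat N) = pochhammer d N * Gamma d"
    using d0 by (simp add: pochhammer_Gamma Gamma_eq_zero_iff)
  finally show ?thesis
    using d0 by (auto simp: d_def pochhammer_eq_0_iff)
qed

section \<open>The inverse factorial series of a quotient of Gamma products\<close>

text \<open>
  With \<open>d = a\<^sub>3\<close> and \<open>\<mu> = b\<^sub>1 - a\<^sub>3\<close>, this multiplies an inverse factorial series by \<open>\<Gamma>(a\<^sub>3) / \<Gamma>(b\<^sub>1)\<close>.
  For \<open>Re \<mu> > 0\<close> the double series obtained from Gauss's theorem converges absolutely. To pass from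
  \<open>\<mu> + 1\<close> to \<open>\<mu>\<close>, \<open>level_step_diff\<close> and summation by parts compare the two series; the boundary term is
  of order \<open>N\<^bsup>-\<alpha>\<^esup>\<close>.
\<close>

lemma level_step_sums:
  assumes sym: "symbol_growth (Re (c + d) - \<alpha> - 2) (\<lambda>k. A k / fact k)"
    and \<alpha>: "0 < \<alpha>" "\<alpha> < Re d"
    and V: "(\<lambda>j. A j * rGamma (c + d + of_nat j)) sums V"
  shows "(\<lambda>k. level_step c \<mu> A k * rGamma (c + d + \<mu> + of_nat k)) sums (V * Gamma d * rGamma (d + \<mu>))"
proof -
  define \<tau> where "\<tau> = Re (c + d) - \<alpha> - 2"
  have \<tau>: "\<tau> > Re c - 2" using \<alpha> by (simp add: \<tau>_def)
  have sym: "symbol_growth \<tau> (\<lambda>k. A k / fact k)" using sym by (simp add: \<tau>_def)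
  have base: "(\<lambda>k. level_step c \<mu> A k * rGamma (c + d + \<mu> + of_nat k)) sums (V * Gamma d * rGamma (d + \<mu>))"
    if \<mu>: "Re \<mu> > 0" for \<mu>
  proof -
    define f where "f = (\<lambda>j n. A j * gauss_term (c + of_nat j) \<mu> (c + d + \<mu> + of_nat j) n)"
    have f: "f j (k - j) = pochhammer (c + of_nat j) (k - j) * rising \<mu> (k - j) * A j * rGamma (c + d + \<mu> + of_nat k)"
      if "j \<le> k" for j k
      using that by (simp add: f_def gauss_term_def of_nat_diff mult_ac add_ac)
    define B where "B = (\<lambda>k. \<Sum>j\<le>k. norm (pochhammer (c + of_nat j) (k - j) * rising \<mu> (k - j) * A j))"
    have "poly_growth (\<tau> + Re \<mu>) (\<lambda>k. complex_of_real (B k / fact k))"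
      using poly_growth_level_step_majorant[OF symbol_growthD[OF sym] \<tau> \<mu>]
      unfolding B_def poly_growth_def norm_of_real real_norm_def .
    hence "poly_growth (\<tau> + Re \<mu> + (1 - Re (c + d + \<mu>)))
       (\<lambda>k. complex_of_real (B k / fact k) * (fact k * rGamma (c + d + \<mu> + of_nat k)))"
      by (intro poly_growth_mult poly_growth_fact_rGamma)
    hence "summable (\<lambda>k. norm (complex_of_real (B k / fact k) * (fact k * rGamma (c + d + \<mu> + of_nat k))))"
      by (rule poly_growth_summable_norm) (use \<alpha> in \<open>simp add: \<tau>_def\<close>)
    also have "(\<lambda>k. norm (complex_of_real (B k / fact k) * (fact k * rGamma (c + d + \<mu> + of_nat k)))) =
      (\<lambda>k. \<Sum>j\<le>k. norm (f j (k - j)))"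
    proof
      fix k
      have "B k \<ge> 0" by (simp add: B_def sum_nonneg)
      moreover have "(\<Sum>j\<le>k. norm (f j (k - j))) = B k * norm (rGamma (c + d + \<mu> + of_nat k))"
        by (simp add: f norm_mult B_def sum_distrib_right)
      ultimately show "norm (complex_of_real (B k / fact k) * (fact k * rGamma (c + d + \<mu> + of_nat k))) =
        (\<Sum>j\<le>k. norm (f j (k - j)))"
        by (simp add: norm_mult norm_divide)
    qed
    finally have "(\<lambda>k. \<Sum>j\<le>k. f j (k - j)) sums (\<Sum>j. \<Sum>n. f j n)"
      by (rule suminf_triangle)
    also have "(\<lambda>k. \<Sum>j\<le>k. f j (k - j)) = (\<lambda>k. level_step c \<mu> A k * rGamma (c + d + \<mu> + of_nat k))"
      by (auto simp: f level_step_def simp flip: sum_distrib_right)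
    also have "(\<lambda>j. \<Sum>n. f j n) = (\<lambda>j. A j * rGamma (c + d + of_nat j) * (Gamma d * rGamma (d + \<mu>)))"
    proof
      fix j
      have "Re (c + d + \<mu> + of_nat j - (c + of_nat j) - \<mu>) > 0" using \<alpha> by simp
      note g = gauss_sum[OF this] summable_norm_cancel[OF summable_norm_gauss_term[OF this]]
      show "(\<Sum>n. f j n) = A j * rGamma (c + d + of_nat j) * (Gamma d * rGamma (d + \<mu>))"
        unfolding f_def suminf_mult[OF g(2)] g(1) by (simp add: algebra_simps)
    qed
    also have "(\<Sum>j. A j * rGamma (c + d + of_nat j) * (Gamma d * rGamma (d + \<mu>))) = V * (Gamma d * rGamma (d + \<mu>))"
      using sums_mult2[OF V] by (rule sums_unique[symmetric])
    finally show ?thesis by (simp add: mult_ac)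
  qed
  have "(\<lambda>k. level_step c \<mu> A k * rGamma (c + d + \<mu> + of_nat k)) sums (V * Gamma d * rGamma (d + \<mu>))"
    if "Re \<mu> + real N > 0" for \<mu> N
    using that
  proof (induction N arbitrary: \<mu>)
    case (Suc N)
    define S where "S = c + d + \<mu>"
    define L where "L = level_step c (\<mu> + 1) A"
    have "(\<lambda>k. L k * rGamma (S + 1 + of_nat k)) sums (V * Gamma d * rGamma (d + \<mu> + 1))"
      using Suc.IH[of "\<mu> + 1"] Suc.prems by (simp add: L_def S_def add_ac)
    hence lim: "(\<lambda>N. \<Sum>k<N. L k * rGamma (S + 1 + of_nat k)) \<longlonglongrightarrow> V * Gamma d * rGamma (d + \<mu> + 1)"
      by (simp add: sums_def)
    have partial: "(\<Sum>k<Suc N. level_step c \<mu> A k * rGamma (S + of_nat k)) =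
      (d + \<mu>) * (\<Sum>k<N. L k * rGamma (S + 1 + of_nat k)) + L N * rGamma (S + of_nat N)" for N
    proof (induction N)
      case (Suc N)
      have 1: "level_step c \<mu> A (Suc N) = L (Suc N) - (c + of_nat N) * L N"
        using level_step_diff[of c "\<mu> + 1" A N] by (simp add: L_def)
      have 2: "rGamma (S + of_nat N) = (S + of_nat N) * rGamma (S + of_nat (Suc N))"
        using rGamma_plus1[of "S + of_nat N"] by (simp add: add_ac)
      have 3: "S + 1 + of_nat N = S + of_nat (Suc N)" by simp
      have 4: "S = c + (d + \<mu>)" by (simp add: S_def)
      show ?case
        unfolding sum.lessThan_Suc[of _ "Suc N"] Suc.IH 1 2 sum.lessThan_Suc[of _ N] 3
        by (simp add: distrib_left distrib_right left_diff_distrib right_diff_distrib mult_ac 4 del: of_nat_Suc)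
    qed (simp add: L_def level_step_def)
    have "poly_growth (\<tau> + Re (\<mu> + 1) + (1 - Re S)) (\<lambda>N. L N / fact N * (fact N * rGamma (S + of_nat N)))"
      unfolding L_def by (intro poly_growth_mult poly_growth_fact_rGamma poly_growth_level_step sym \<tau>)
    hence "(\<lambda>N. L N / fact N * (fact N * rGamma (S + of_nat N))) \<longlonglongrightarrow> 0"
      by (rule poly_growth_tendsto_0) (use \<alpha> in \<open>simp add: \<tau>_def S_def\<close>)
    hence "(\<lambda>N. L N * rGamma (S + of_nat N)) \<longlonglongrightarrow> 0" by simp
    with lim have "(\<lambda>N. \<Sum>k<Suc N. level_step c \<mu> A k * rGamma (S + of_nat k)) \<longlonglongrightarrow>
       (d + \<mu>) * (V * Gamma d * rGamma (d + \<mu> + 1)) + 0"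
      unfolding partial by (intro tendsto_intros)
    also have "(d + \<mu>) * (V * Gamma d * rGamma (d + \<mu> + 1)) + 0 = V * Gamma d * rGamma (d + \<mu>)"
      by (simp flip: rGamma_plus1[of "d + \<mu>"])
    finally show ?case
      unfolding sums_def S_def by (rule LIMSEQ_imp_Suc)
  qed (use base in simp)
  moreover obtain N where "- Re \<mu> < real N" using reals_Archimedean2 by blast
  hence "Re \<mu> + real N > 0" by simp
  ultimately show ?thesis by blast
qed

text \<open>
  At level \<open>p\<close> this is the quantity \<open>S\<close> of the introductory remarks.
\<close>

definition level_excess :: "nat \<Rightarrow> (nat \<Rightarrow> complex) \<Rightarrow> (nat \<Rightarrow> complex) \<Rightarrow> complex" where
  "level_excess p a b = (\<Sum>i=1..p. b i) - (\<Sum>i=3..p+1. a i)"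

lemma coeffA_Suc_Suc:
  fixes a b q
  defines "a' \<equiv> (\<lambda>i. a (i + 1))" and "b' \<equiv> (\<lambda>i. b (i + 1))"
  shows "coeffA (Suc (Suc q)) a b k =
    level_step (level_excess (Suc q) a' b' - a 3) (b 1 - a 3) (coeffA (Suc q) a' b') k"
    and "level_excess (Suc (Suc q)) a b = level_excess (Suc q) a' b' + (b 1 - a 3)"
proof -
  have sb: "(\<Sum>i=2..Suc (Suc q). b i) = (\<Sum>i=1..Suc q. b' i)"
    unfolding b'_def using sum.shift_bounds_cl_nat_ivl[of b 1 1 "Suc q"] by (simp add: numeral_2_eq_2)
  have sa: "(\<Sum>i=3..Suc (Suc q) + 1. a i) = a 3 + (\<Sum>i=3..Suc q + 1. a' i)"
    unfolding a'_def using sum.shift_bounds_cl_nat_ivl[of a 3 1 "Suc q + 1"]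
    by (subst sum.atLeast_Suc_atMost) (simp_all add: eval_nat_numeral)
  have sb1: "(\<Sum>i=1..Suc (Suc q). b i) = b 1 + (\<Sum>i=2..Suc (Suc q). b i)"
    by (subst sum.atLeast_Suc_atMost) (simp_all add: numeral_2_eq_2)
  show "level_excess (Suc (Suc q)) a b = level_excess (Suc q) a' b' + (b 1 - a 3)"
    unfolding level_excess_def sb1 sa sb by simp
  have "(\<Sum>i=2..Suc (Suc q). b i) - (\<Sum>i=3..Suc (Suc q) + 1. a i) = level_excess (Suc q) a' b' - a 3"
    unfolding level_excess_def sa sb by simp
  thus "coeffA (Suc (Suc q)) a b k =
    level_step (level_excess (Suc q) a' b' - a 3) (b 1 - a 3) (coeffA (Suc q) a' b') k"
    unfolding coeffA.simps(3) Let_def level_step_def a'_def b'_def atMost_atLeast0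
    by (simp add: rising_def)
qed

text \<open>
  The recursion involves only differences of as many \<open>b\<^sub>i\<close> as \<open>a\<^sub>i\<close>. Hence the expansion at
  \<open>a\<^sub>j, b\<^sub>j\<close> yields the one at \<open>a\<^sub>j + l, b\<^sub>j + l\<close> with the same coefficients.
\<close>

lemma coeffA_shift: "coeffA p (\<lambda>i. a i + z) (\<lambda>i. b i + z) k = coeffA p a b k"
proof (induction p a b k rule: coeffA.induct)
  case (3 q a b k)
  show ?case
    unfolding coeffA.simps(3) Let_def using "3.IH"[OF refl] by (simp add: sum.distrib)
qed auto

lemma level_excess_shift:
  "level_excess (Suc q) (\<lambda>i. a i + z) (\<lambda>i. b i + z) = level_excess (Suc q) a b + z"
  by (simp add: level_excess_def sum.distrib algebra_simps)

lemma symbol_growth_coeffA: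
  assumes "\<forall>j\<in>{3..Suc q + 1}. \<alpha> < Re (a j)"
  shows "symbol_growth (Re (level_excess (Suc q) a b) - \<alpha> - 2) (\<lambda>k. coeffA (Suc q) a b k / fact k)"
  using assms
proof (induction q arbitrary: a b)
  \<comment> \<open>At the lowest level only the coefficient with index \<open>0\<close> is nonzero, so every exponent will do.\<close>
  case 0
  show ?case unfolding symbol_growth_def by (auto intro!: diff_growth_eventually_zero[of 0])
next
  case (Suc q)
  define a' b' where "a' = (\<lambda>i. a (i + 1))" and "b' = (\<lambda>i. b (i + 1))"
  note step = coeffA_Suc_Suc[of q a b, folded a'_def b'_def]
  have "symbol_growth (Re (level_excess (Suc q) a' b') - \<alpha> - 2) (\<lambda>k. coeffA (Suc q) a' b' k / fact k)"
    using Suc.prems by (intro Suc.IH) (auto simp: a'_def)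
  moreover have "\<alpha> < Re (a 3)" using Suc.prems by auto
  ultimately show ?case
    using symbol_growth_level_step[where \<mu> = "b 1 - a 3" and c = "level_excess (Suc q) a' b' - a 3"
       and A = "coeffA (Suc q) a' b'" and \<tau> = "Re (level_excess (Suc q) a' b') - \<alpha> - 2"]
    unfolding step by (simp add: algebra_simps)
qed

lemma coeffA_sums:
  assumes "\<alpha> > 0" "\<forall>j\<in>{3..Suc q + 1}. \<alpha> < Re (a j)"
  shows "(\<lambda>k. coeffA (Suc q) a b k * rGamma (level_excess (Suc q) a b + of_nat k)) sums
           ((\<Prod>j=3..Suc q + 1. Gamma (a j)) * (\<Prod>j=1..Suc q. rGamma (b j)))"
  using assms(2)
proof (induction q arbitrary: a b)
  case 0
  have "(\<lambda>k. coeffA (Suc 0) a b k * rGamma (level_excess (Suc 0) a b + of_nat k)) sums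
     (\<Sum>k\<in>{0}. coeffA (Suc 0) a b k * rGamma (level_excess (Suc 0) a b + of_nat k))"
    by (rule sums_finite) auto
  thus ?case by (simp add: level_excess_def)
next
  case (Suc q)
  define a' b' where "a' = (\<lambda>i. a (i + 1))" and "b' = (\<lambda>i. b (i + 1))"
  note step = coeffA_Suc_Suc[of q a b, folded a'_def b'_def]
  define c where "c = level_excess (Suc q) a' b' - a 3"
  have E: "level_excess (Suc q) a' b' = c + a 3" by (simp add: c_def)
  have a': "\<forall>j\<in>{3..Suc q + 1}. \<alpha> < Re (a' j)" using Suc.prems by (auto simp: a'_def)
  have pb: "(\<Prod>j=1..Suc (Suc q). rGamma (b j)) = rGamma (b 1) * (\<Prod>j=1..Suc q. rGamma (b' j))"
    unfolding b'_def using prod.shift_bounds_cl_nat_ivl[of "\<lambda>j. rGamma (b j)" 1 1 "Suc q"]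
    by (subst prod.atLeast_Suc_atMost) simp_all
  have pa: "(\<Prod>j=3..Suc (Suc q) + 1. Gamma (a j)) = Gamma (a 3) * (\<Prod>j=3..Suc q + 1. Gamma (a' j))"
    unfolding a'_def using prod.shift_bounds_cl_nat_ivl[of "\<lambda>j. Gamma (a j)" 3 1 "Suc q + 1"]
    by (subst prod.atLeast_Suc_atMost) (simp_all add: eval_nat_numeral)
  have "(\<lambda>k. level_step c (b 1 - a 3) (coeffA (Suc q) a' b') k * rGamma (c + a 3 + (b 1 - a 3) + of_nat k)) sums
     ((\<Prod>j=3..Suc q + 1. Gamma (a' j)) * (\<Prod>j=1..Suc q. rGamma (b' j)) * Gamma (a 3) * rGamma (a 3 + (b 1 - a 3)))"
    using Suc.prems symbol_growth_coeffA[OF a', of b'] Suc.IH[OF a', of b'] assms(1)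
    by (intro level_step_sums[where \<alpha> = \<alpha>]) (simp_all add: E)
  moreover have "a 3 + (b 1 - a 3) = b 1" by simp
  ultimately show ?case
    unfolding step E pa pb by (simp add: c_def[symmetric] mult_ac)
qed

section \<open>Summation over the index of the hypergeometric series\<close>

lemma partial_sum_error_bigo:
  fixes x :: "nat \<Rightarrow> complex"
  assumes growth: "poly_growth (- \<sigma> - 1) x" and \<sigma>: "\<sigma> > 0" and X: "x sums X"
  shows "(\<lambda>m. norm ((\<Sum>l<m. x l) - X)) \<in> O(\<lambda>m. real m powr (- \<sigma>))"
proof -
  \<comment> \<open>A telescoping majorant: its terms are of the order \<open>l\<^bsup>-\<sigma>-1\<^esup>\<close> and its tails are \<open>m\<^bsup>-\<sigma>\<^esup>\<close>.\<close>
  define y where "y = (\<lambda>l. real l powr (-\<sigma>) - real (Suc l) powr (-\<sigma>))"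
  have "(\<lambda>l. norm (x l)) \<in> O(\<lambda>l. real l powr (- \<sigma> - 1))" using growth by (simp add: poly_growth_def)
  also have "(\<lambda>l. real l powr (- \<sigma> - 1)) \<in> O(y)"
    unfolding y_def using \<sigma> by real_asymp
  finally obtain c where c: "c > 0" "eventually (\<lambda>l. norm (norm (x l)) \<le> c * norm (y l)) at_top"
    by (rule landau_o.bigE)
  from c(2) obtain N where N: "\<And>l. l \<ge> N \<Longrightarrow> norm (x l) \<le> c * norm (y l)"
    by (auto simp: eventually_at_top_linorder)
  have y0: "y l \<ge> 0" if "l > 0" for l
    unfolding y_def using \<sigma> that by (auto intro!: powr_mono2')
  \<comment> \<open>\<open>m \<ge> 1\<close> keeps the bound away from \<open>0 powr (-\<sigma>) = 0\<close>.\<close>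
  have "norm ((\<Sum>l<m. x l) - X) \<le> c * real m powr (-\<sigma>)" if m: "m \<ge> max N 1" for m
  proof -
    have "(\<lambda>n. real (n + m) powr (-\<sigma>)) \<longlonglongrightarrow> 0"
      using \<sigma> by real_asymp
    from telescope_sums'[OF this] have "(\<lambda>n. y (n + m)) sums (real m powr (-\<sigma>))"
      by (simp add: y_def)
    hence ys: "(\<lambda>n. c * y (n + m)) sums (c * real m powr (-\<sigma>))" by (rule sums_mult)
    have "(\<lambda>n. x (n + m)) sums (X - (\<Sum>l<m. x l))"
      using X by (simp add: sums_iff_shift)
    hence "norm ((\<Sum>l<m. x l) - X) = norm (\<Sum>n. x (n + m))"
      by (simp add: sums_iff norm_minus_commute)
    also have "\<dots> \<le> (\<Sum>n. c * y (n + m))"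
    proof (rule norm_suminf_le)
      show "summable (\<lambda>n. c * y (n + m))" using ys by (simp add: sums_iff)
      fix n show "norm (x (n + m)) \<le> c * y (n + m)"
        using N[of "n + m"] y0[of "n + m"] m by simp
    qed
    also have "\<dots> = c * real m powr (-\<sigma>)" using ys by (simp add: sums_iff)
    finally show ?thesis .
  qed
  thus ?thesis
    by (intro bigoI[of _ c] eventually_mono[OF eventually_ge_at_top[of "max N 1"]]) auto
qed

text \<open>
  The sum over \<open>l\<close> for fixed \<open>k\<close> is Gauss's. For the interchange, the absolute values are bounded, once
  \<open>k \<ge> K\<close> with \<open>Re (S + K) > 0\<close>, by a product of a summable function of \<open>k\<close> and the summable terms
  for \<open>k = K\<close>, because \<open>\<bar>pochhammer (S + k) l\<bar>\<close> does not decrease with \<open>k\<close> from there on.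
\<close>

lemma sum_gauss_terms_swap:
  assumes a: "a1 \<notin> \<int>\<^sub>\<le>\<^sub>0" "a2 \<notin> \<int>\<^sub>\<le>\<^sub>0" and s: "Re s > 0"
    and A: "summable (\<lambda>k. norm (A k * rGamma (s + a1 + a2 + of_nat k)))"
  defines "g \<equiv> (\<lambda>k. pochhammer s k * rGamma (a1 + s + of_nat k) * rGamma (a2 + s + of_nat k) * A k)"
  shows "summable g"
    and "(\<lambda>l. Gamma (a1 + of_nat l) * Gamma (a2 + of_nat l) * rGamma (1 + of_nat l) *
            (\<Sum>k. A k * rGamma (s + a1 + a2 + of_nat l + of_nat k)))
          sums (Gamma a1 * Gamma a2 * Gamma s * (\<Sum>k. g k))"
proof -
  define S where "S = s + a1 + a2"
  define G where "G = Gamma a1 * Gamma a2"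
  define f where "f = (\<lambda>k l. G * A k * gauss_term a1 a2 (S + of_nat k) l)"
  have d: "Re (S + of_nat k - a1 - a2) > 0" for k using s by (simp add: S_def)
  have s0: "s \<notin> \<int>\<^sub>\<le>\<^sub>0" using s by (rule not_nonpos_Int_if_Re_pos)
  have row: "summable (\<lambda>l. norm (f k l))" for k
    unfolding f_def norm_mult by (intro summable_mult summable_norm_gauss_term d)
  obtain K where "- Re S < real K" using reals_Archimedean2 by blast
  hence K: "Re (S + of_nat K) > 0" by simp
  define W where "W = norm G * norm (Gamma (S + of_nat K)) * (\<Sum>l. norm (gauss_term a1 a2 (S + of_nat K) l))"
  have total: "summable (\<lambda>k. \<Sum>l. norm (f k l))"
  proof (rule summable_comparison_test)
    show "summable (\<lambda>k. norm (A k * rGamma (S + of_nat k)) * W)"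
      using A unfolding S_def by (rule summable_mult2)
    show "\<exists>N. \<forall>k\<ge>N. norm (\<Sum>l. norm (f k l)) \<le> norm (A k * rGamma (S + of_nat k)) * W"
    proof (intro exI[of _ K] allI impI)
      fix k assume k: "k \<ge> K"
      define M where "M = norm G * norm (A k * rGamma (S + of_nat k)) * norm (Gamma (S + of_nat K))"
      have le: "norm (f k l) \<le> M * norm (gauss_term a1 a2 (S + of_nat K) l)" for l
      proof -
        define P where "P = pochhammer (S + of_nat K) l"
        define Q where "Q = pochhammer (S + of_nat k) l"
        define t where "t = norm (pochhammer a1 l * rising a2 l)"
        have nz: "S + of_nat K \<notin> \<int>\<^sub>\<le>\<^sub>0" using K by (rule not_nonpos_Int_if_Re_pos)
        hence P0: "norm P > 0" by (auto simp: P_def pochhammer_eq_0_iff)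
        have "S + of_nat k = S + of_nat K + of_nat (k - K)" using k by (simp add: of_nat_diff)
        hence PQ: "norm P \<le> norm Q" unfolding P_def Q_def using norm_pochhammer_mono[OF K] by metis
        have "norm (rGamma (S + of_nat k)) = norm Q * norm (rGamma (S + of_nat k + of_nat l))"
          unfolding Q_def norm_mult[symmetric] by (simp flip: pochhammer_rGamma)
        hence 1: "norm P * norm (rGamma (S + of_nat k + of_nat l)) \<le> norm (rGamma (S + of_nat k))"
          using PQ by (auto intro!: mult_right_mono)
        have "rGamma (S + of_nat K) = P * rGamma (S + of_nat K + of_nat l)"
          unfolding P_def by (rule pochhammer_rGamma)
        moreover have "Gamma (S + of_nat K) * rGamma (S + of_nat K) = 1"
          using nz by (simp add: rGamma_inverse_Gamma Gamma_eq_zero_iff)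
        ultimately have "norm P * norm (Gamma (S + of_nat K) * rGamma (S + of_nat K + of_nat l)) = 1"
          by (metis mult.left_commute norm_mult norm_one)
        hence 2: "norm (Gamma (S + of_nat K) * rGamma (S + of_nat K + of_nat l)) = 1 / norm P"
          using P0 by (simp add: field_simps)
        have "norm (f k l) = norm G * norm (A k) * t * norm (rGamma (S + of_nat k + of_nat l))"
          by (simp add: f_def gauss_term_def t_def norm_mult)
        also have "\<dots> \<le> norm G * norm (A k) * t * (norm (rGamma (S + of_nat k)) / norm P)"
          using 1 P0 by (intro mult_left_mono) (auto simp: t_def field_simps)
        also have "\<dots> = norm G * norm (A k * rGamma (S + of_nat k)) * t * (1 / norm P)"
          by (simp add: norm_mult)
        also have "\<dots> = M * norm (gauss_term a1 a2 (S + of_nat K) l)"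
          unfolding 2[symmetric] by (simp add: M_def gauss_term_def t_def norm_mult)
        finally show ?thesis .
      qed
      have sm: "summable (\<lambda>l. norm (gauss_term a1 a2 (S + of_nat K) l))"
        by (rule summable_norm_gauss_term[OF d])
      have "norm (\<Sum>l. norm (f k l)) = (\<Sum>l. norm (f k l))"
        using row[of k] by (simp add: suminf_nonneg)
      also have "\<dots> \<le> (\<Sum>l. M * norm (gauss_term a1 a2 (S + of_nat K) l))"
        by (intro suminf_le le row summable_mult sm)
      also have "\<dots> = norm (A k * rGamma (S + of_nat k)) * W"
        unfolding suminf_mult[OF sm] by (simp add: M_def W_def mult_ac)
      finally show "norm (\<Sum>l. norm (f k l)) \<le> norm (A k * rGamma (S + of_nat k)) * W" .
    qed
  qed
  have row_sum: "(\<Sum>l. f k l) = G * Gamma s * g k" for k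
  proof -
    have "(\<Sum>l. f k l) = G * A k * (\<Sum>l. gauss_term a1 a2 (S + of_nat k) l)"
      unfolding f_def by (rule suminf_mult[OF summable_norm_cancel[OF summable_norm_gauss_term[OF d]]])
    also have "\<dots> = G * A k * (Gamma (s + of_nat k) * rGamma (a2 + s + of_nat k) * rGamma (a1 + s + of_nat k))"
      unfolding gauss_sum[OF d] by (simp add: S_def algebra_simps)
    also have "Gamma (s + of_nat k) = pochhammer s k * Gamma s"
      using s0 by (simp add: pochhammer_Gamma Gamma_eq_zero_iff)
    finally show ?thesis by (simp add: g_def mult_ac)
  qed
  have G0: "G * Gamma s \<noteq> 0" using a s0 by (simp add: G_def Gamma_eq_zero_iff)
  have "summable (\<lambda>k. \<Sum>l. f k l)"
    by (rule summable_comparison_test[OF _ total]) (auto intro!: exI[of _ 0] summable_norm row)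
  thus g: "summable g"
    unfolding row_sum by (subst (asm) summable_cmult_iff) (use G0 in auto)
  have "(\<Sum>k. f k l) = Gamma (a1 + of_nat l) * Gamma (a2 + of_nat l) * rGamma (1 + of_nat l) *
            (\<Sum>k. A k * rGamma (s + a1 + a2 + of_nat l + of_nat k))" for l
  proof -
    define C where "C = Gamma (a1 + of_nat l) * Gamma (a2 + of_nat l) * rGamma (1 + of_nat l)"
    have fl: "f k l = C * (A k * rGamma (s + a1 + a2 + of_nat l + of_nat k))" for k
      using a by (simp add: f_def gauss_term_def G_def C_def S_def rising_def pochhammer_Gamma
          Gamma_eq_zero_iff rGamma_inverse_Gamma[of "1 + of_nat l"] Gamma_fact add_ac field_simps)
    \<comment> \<open>Needed to read off the convergence of the series for the quotient from that of \<open>f\<close>.\<close>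
    have "C \<noteq> 0"
    proof -
      have "z + of_nat l \<notin> \<int>\<^sub>\<le>\<^sub>0" if "z \<notin> \<int>\<^sub>\<le>\<^sub>0" for z :: complex
        using that by (metis mult_zero_right pochhammer_rGamma rGamma_eq_zero_iff)
      from this[OF a(1)] this[OF a(2)] this[of 1] show ?thesis
        by (simp add: C_def Gamma_eq_zero_iff rGamma_eq_zero_iff)
    qed
    moreover have "summable (\<lambda>k. f k l)"
      by (rule summable_norm_cancel[OF suminf_swap(2)[OF row total]])
    ultimately have "summable (\<lambda>k. A k * rGamma (s + a1 + a2 + of_nat l + of_nat k))"
      unfolding fl by (simp add: summable_cmult_iff)
    thus ?thesis unfolding fl C_def[symmetric] by (rule suminf_mult)
  qed
  with suminf_swap(1)[OF row total]
  show "(\<lambda>l. Gamma (a1 + of_nat l) * Gamma (a2 + of_nat l) * rGamma (1 + of_nat l) *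
            (\<Sum>k. A k * rGamma (s + a1 + a2 + of_nat l + of_nat k)))
          sums (Gamma a1 * Gamma a2 * Gamma s * (\<Sum>k. g k))"
    unfolding row_sum by (simp add: suminf_mult[OF g] G_def)
qed

theorem theorem2:
  fixes p :: nat and a b :: "nat \<Rightarrow> complex"
  assumes "p \<ge> 1"
    and "\<forall>j\<in>{1..p+1}. a j \<notin> \<int>\<^sub>\<le>\<^sub>0"
    and "\<forall>j\<in>{3..p+1}. Re (a j) > 0"
    and "Re (excess p a b) > 0"
  shows "summable (g0_term p a b) \<and>
    (\<lambda>m. norm (hyp_partial_sum p a b m - g0_at_0 p a b))
      \<in> O(\<lambda>m. real m powr (- Re (excess p a b)))"
proof -
  obtain q where p: "p = Suc q" using assms(1) by (cases p) auto
  define s where "s = excess p a b"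
  define A where "A = coeffA p a b"
  define x where "x = (\<lambda>l. (\<Prod>j=1..p+1. Gamma (a j + of_nat l)) * (\<Prod>j=1..p. rGamma (b j + of_nat l))
             * rGamma (1 + of_nat l))"
  have nonpole: "a 1 \<notin> \<int>\<^sub>\<le>\<^sub>0" "a 2 \<notin> \<int>\<^sub>\<le>\<^sub>0" using assms(1,2) by auto
  have s: "Re s > 0" using assms(4) by (simp add: s_def)
  have split12: "{1..p+1} = insert 1 (insert 2 {3..p+1})" using assms(1) by auto
  have S: "level_excess p a b = s + a 1 + a 2"
    unfolding level_excess_def s_def excess_def split12 by simp
  \<comment> \<open>A positive exponent below all \<open>Re (a j)\<close>; the \<open>1\<close> in the minimum covers \<open>p = 1\<close>, where there are none.\<close>
  obtain \<alpha> where \<alpha>: "\<alpha> > 0" "\<forall>j\<in>{3..p+1}. \<alpha> < Re (a j)"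
  proof
    let ?M = "Min (insert 1 ((\<lambda>j. Re (a j)) ` {3..p+1}))"
    have M: "?M > 0" using assms(3) by (subst Min_gr_iff) auto
    thus "?M / 2 > 0" by simp
    show "\<forall>j\<in>{3..p+1}. ?M / 2 < Re (a j)"
    proof
      fix j assume "j \<in> {3..p+1}"
      hence "?M \<le> Re (a j)" by (intro Min_le) auto
      with M show "?M / 2 < Re (a j)" by linarith
    qed
  qed
  have "poly_growth ((Re (level_excess p a b) - \<alpha> - 2) + (1 - Re (level_excess p a b)))
    (\<lambda>k. A k / fact k * (fact k * rGamma (level_excess p a b + of_nat k)))"
    unfolding A_def p using \<alpha>(2)
    by (intro poly_growth_mult poly_growth_fact_rGamma symbol_growthD symbol_growth_coeffA) (simp add: p)
  hence "summable (\<lambda>k. norm (A k / fact k * (fact k * rGamma (level_excess p a b + of_nat k))))"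
    by (rule poly_growth_summable_norm) (use \<alpha>(1) in simp)
  hence A: "summable (\<lambda>k. norm (A k * rGamma (s + a 1 + a 2 + of_nat k)))"
    by (simp add: S)
  note ds = sum_gauss_terms_swap[OF nonpole s A]
  have g: "(\<lambda>k. pochhammer s k * rGamma (a 1 + s + of_nat k) * rGamma (a 2 + s + of_nat k) * A k) = g0_term p a b"
    by (auto simp: g0_term_def s_def A_def)
  have inner: "(\<Sum>k. A k * rGamma (s + a 1 + a 2 + of_nat l + of_nat k)) =
     (\<Prod>j=3..p+1. Gamma (a j + of_nat l)) * (\<Prod>j=1..p. rGamma (b j + of_nat l))" for l
  proof -
    have "\<forall>j\<in>{3..Suc q+1}. \<alpha> < Re (a j + of_nat l)"
      using \<alpha>(2) by (auto simp: p intro: less_le_trans)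
    from coeffA_sums[OF \<alpha>(1) this, of "\<lambda>i. b i + of_nat l"] show ?thesis
      unfolding coeffA_shift level_excess_shift by (simp add: A_def p[symmetric] S sums_iff)
  qed
  have "(\<lambda>l. Gamma (a 1 + of_nat l) * Gamma (a 2 + of_nat l) * rGamma (1 + of_nat l) *
     ((\<Prod>j=3..p+1. Gamma (a j + of_nat l)) * (\<Prod>j=1..p. rGamma (b j + of_nat l)))) sums g0_at_0 p a b"
    using ds(2) unfolding g inner by (simp only: g0_at_0_def s_def)
  also have "(\<lambda>l. Gamma (a 1 + of_nat l) * Gamma (a 2 + of_nat l) * rGamma (1 + of_nat l) *
     ((\<Prod>j=3..p+1. Gamma (a j + of_nat l)) * (\<Prod>j=1..p. rGamma (b j + of_nat l)))) = x"
    unfolding x_def split12 by (auto simp: mult_ac)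
  finally have x: "x sums g0_at_0 p a b" .
  \<comment> \<open>Pairing the \<open>p + 1\<close> numerator factors with the \<open>p + 1\<close> denominator factors, the last of which is \<open>\<Gamma>(1+l)\<close>.\<close>
  have "poly_growth ((\<Sum>j=1..p. Re (a j) - Re (b j)) + (Re (a (Suc p)) - Re 1))
     (\<lambda>l. (\<Prod>j=1..p. Gamma (a j + of_nat l) * rGamma (b j + of_nat l)) *
        (Gamma (a (Suc p) + of_nat l) * rGamma (1 + of_nat l)))"
    using assms(2) by (intro poly_growth_mult poly_growth_prod poly_growth_Gamma_ratio) auto
  also have "(\<lambda>l. (\<Prod>j=1..p. Gamma (a j + of_nat l) * rGamma (b j + of_nat l)) *
        (Gamma (a (Suc p) + of_nat l) * rGamma (1 + of_nat l))) = x"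
    by (auto simp: x_def prod.distrib mult_ac)
  also have "(\<Sum>j=1..p. Re (a j) - Re (b j)) + (Re (a (Suc p)) - Re 1) = - Re s - 1"
    by (simp add: s_def excess_def sum_subtractf)
  finally have "(\<lambda>m. norm ((\<Sum>l<m. x l) - g0_at_0 p a b)) \<in> O(\<lambda>m. real m powr (- Re s))"
    using s x by (rule partial_sum_error_bigo)
  thus ?thesis
    using ds(1) unfolding g by (simp add: x_def hyp_partial_sum_def s_def)
qed

end
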